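(* Let $\mathcal{X}$ be a non-empty finite set. For each integer $n\geq1$ let $\mathcal{A}^n\subseteq\mathcal{G}(\mathcal{X}^n)$ be a set of gambles on $\mathcal{X}^n$, and consider the set of polynomials $$\mathcal{A}:=\bigcup_{n\geq1}\mathrm{Mn}^n(\mathcal{A}^n)\subseteq\mathcal{V}(\Sigma_{\mathcal{X}}).$$ Then there is a coherent, exchangeable and time-consistent family $(\mathcal{R}^n)_{n\geq1}$ that includes this assessment (i.e. $\mathcal{A}^n\subseteq\mathcal{R}^n$ for all $n\geq1$) if and only if $\mathcal{A}$ avoids Bernstein non-positivity, and in that case $\mathcal{E}_{\mathrm{Be}}(\mathcal{A})$ is the frequency representation of the (element-wise) smallest coherent, exchangeable and time-consistent family that includes this assessment.
   Context: A gamble on a non-empty set $\Omega$ is a bounded function $\Omega\to\mathbb{R}$; $\mathcal{G}(\Omega)$ is the linear space of all gambles on $\Omega$. Write $f\geq g$ for the pointwise ordering, and $f>g$ iff $f\geq g$ and $f\neq g$. A set $\mathcal{R}\subseteq\mathcal{G}(\Omega)$ is coherent if: $0\notin\mathcal{R}$; $f>0$ implies $f\in\mathcal{R}$; $f\in\mathcal{R}$ and $\lambda>0$ imply $\lambda f\in\mathcal{R}$; $f_1,f_2\in\mathcal{R}$ implies $f_1+f_2\in\mathcal{R}$. For a permutation $\pi$ of $\{1,\dots,n\}$ put $\pi(x_1,\dots,x_n)=(x_{\pi(1)},\dots,x_{\pi(n)})$ and $\pi^tf=f\circ\pi$. A coherent set $\mathcal{R}\subseteq\mathcal{G}(\mathcal{X}^n)$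 is exchangeable if $h+(f-\pi^tf)\in\mathcal{R}$ for all $h\in\mathcal{R}$, $f\in\mathcal{G}(\mathcal{X}^n)$ and all permutations $\pi$. For $1\leq n_1\leq n_2$ and $f\in\mathcal{G}(\mathcal{X}^{n_1})$, $\mathrm{ext}_{n_1}^{n_2}(f)(x_1,\dots,x_{n_2})=f(x_1,\dots,x_{n_1})$. A family $(\mathcal{R}^n)_{n\geq1}$ with $\mathcal{R}^n\subseteq\mathcal{G}(\mathcal{X}^n)$ is coherent, exchangeable and time-consistent if each $\mathcal{R}^n$ is coherent and exchangeable and $\mathrm{ext}_{n_1}^{n_2}(\mathcal{R}^{n_1})=\mathcal{R}^{n_2}\cap\mathrm{ext}_{n_1}^{n_2}(\mathcal{G}(\mathcal{X}^{n_1}))$ for all $1\leq n_1\leq n_2$. For $n\geq0$, $\mathcal{N}^n=\{m\in\mathbb{Z}_{\geq0}^{\mathcal{X}}:\sum_zm_z=n\}$; for $m\in\mathcal{N}^n$, $[m]$ is the set of $x\in\mathcal{X}^n$ in which each $z\in\mathcal{X}$ occurs exactly $m_z$ times; $|[m]|=n!/\prod_zm_z!$. $\Sigma_{\mathcal{X}}=\{\theta\in\mathbb{R}^{\mathcal{X}}:\theta\geq0,\sum_x\theta_x=1\}$; $\mathcal{V}(\Sigma_{\mathcal{X}})$ is the linear space of polynomial functions on $\Sigma_{\mathcal{X}}$, and $\deg(p)$ is the smallest degree of a polynomial representing $p$ on $\Sigma_{\mathcal{X}}$ (with $\deg(0)=0$); $B_m(\theta)=|[m]|\prod_z\theta_z^{m_z}$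 ($0^0=1$). For $n\geq\deg(p)$ there is a unique $b_p^n\in\mathcal{G}(\mathcal{N}^n)$ with $p=\sum_{m\in\mathcal{N}^n}b_p^n(m)B_m$. For $f\in\mathcal{G}(\mathcal{X}^n)$, $\mathrm{Mn}^n(f)=\sum_{m\in\mathcal{N}^n}\bigl(\frac1{|[m]|}\sum_{y\in[m]}f(y)\bigr)B_m$. The frequency representation of a coherent, exchangeable and time-consistent family $(\mathcal{R}^n)_{n\geq1}$ is $\bigcup_{n\geq1}\mathrm{Mn}^n(\mathcal{R}^n)$. For a set $\mathcal{A}$ of polynomials, $\mathrm{posi}(\mathcal{A})=\{\sum_{k=1}^n\lambda_kp_k:n\geq1,p_k\in\mathcal{A},\lambda_k>0\}$; $\mathcal{A}$ avoids Bernstein non-positivity if no $p\in\mathrm{posi}(\mathcal{A})$ satisfies $b_p^n\leq0$ for some $n\geq\deg(p)$. A set $\mathcal{H}\subseteq\mathcal{V}(\Sigma_{\mathcal{X}})$ is Bernstein coherent if for all $p,p_1,p_2\in\mathcal{V}(\Sigma_{\mathcal{X}})$ and real $\lambda>0$: $0\notin\mathcal{H}$; if $b_p^n>0$ for some $n\geq\deg(p)$ then $p\in\mathcal{H}$; $p\in\mathcal{H}$ implies $\lambda p\in\mathcal{H}$; $p_1,p_2\in\mathcal{H}$ implies $p_1+p_2\in\mathcal{H}$. The Bernstein natural extension $\mathcal{E}_{\mathrm{Be}}(\mathcal{A})$ is the intersection of all Bernstein coherent sets that include $\mathcal{A}$ (equal to $\mathcal{V}(\Sigma_{\mathcal{X}})$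 if there are none). *)

theory Defs
  imports
    "HOL-Analysis.Elementary_Metric_Spaces"
    "HOL-Combinatorics.Permutations"
    "HOL-Library.Poly_Mapping"
begin

text \<open>
  A function on a set \<open>\<Omega>\<close> is represented by its extension by 0 to the whole ambient type. Under this
  convention equality and the pointwise orderings \<open>\<le>\<close>, \<open><\<close> of functions on \<open>\<Omega>\<close> are the ones of
  the function type; in particular \<open>f < g\<close> means \<open>f \<le> g\<close> and \<open>f \<noteq> g\<close>.
\<close>

definition gambles :: "'b set \<Rightarrow> ('b \<Rightarrow> real) set" where
  "gambles \<Omega> = {f. bounded (f ` \<Omega>) \<and> (\<forall>x. x \<notin> \<Omega> \<longrightarrow> f x = 0)}"

definition coherent_set :: "'b set \<Rightarrow> ('b \<Rightarrow> real) set \<Rightarrow> bool" where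
  "coherent_set \<Omega> R \<longleftrightarrow>
     R \<subseteq> gambles \<Omega> \<and>
     (\<lambda>_. 0) \<notin> R \<and>
     (\<forall>f\<in>gambles \<Omega>. (\<lambda>_. 0) < f \<longrightarrow> f \<in> R) \<and>
     (\<forall>f\<in>R. \<forall>c>0. (\<lambda>x. c * f x) \<in> R) \<and>
     (\<forall>f\<in>R. \<forall>g\<in>R. (\<lambda>x. f x + g x) \<in> R)"

definition tuples :: "nat \<Rightarrow> 'a list set" where
  "tuples n = {x. length x = n}"

text \<open>Positions in a tuple are counted from 0, so permutations act on \<open>{..<n}\<close>.\<close>

definition exchangeable_set :: "nat \<Rightarrow> ('a list \<Rightarrow> real) set \<Rightarrow> bool" where
  "exchangeable_set n R \<longleftrightarrow>
     (\<forall>h\<in>R. \<forall>f\<in>gambles (tuples n). \<forall>\<pi>. \<pi> permutes {..<n} \<longrightarrow>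
        (\<lambda>x. h x + (f x - f (permute_list \<pi> x))) \<in> R)"

definition ext :: "nat \<Rightarrow> nat \<Rightarrow> ('a list \<Rightarrow> real) \<Rightarrow> 'a list \<Rightarrow> real" where
  "ext n1 n2 f = (\<lambda>x. if x \<in> tuples n2 then f (take n1 x) else 0)"

text \<open>
  Families \<open>(R\<^sup>n)\<close> with \<open>n \<ge> 1\<close> are functions on \<^typ>\<open>nat\<close> whose value at 0 is never used.
\<close>

definition time_consistent :: "(nat \<Rightarrow> ('a list \<Rightarrow> real) set) \<Rightarrow> bool" where
  "time_consistent R \<longleftrightarrow>
     (\<forall>n1 n2. 1 \<le> n1 \<and> n1 \<le> n2 \<longrightarrow>
        ext n1 n2 ` R n1 = R n2 \<inter> ext n1 n2 ` gambles (tuples n1))"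

definition coherent_exch_tc_family :: "(nat \<Rightarrow> ('a list \<Rightarrow> real) set) \<Rightarrow> bool" where
  "coherent_exch_tc_family R \<longleftrightarrow>
     (\<forall>n\<ge>1. coherent_set (tuples n) (R n) \<and> exchangeable_set n (R n)) \<and> time_consistent R"

definition includes_assessment ::
    "(nat \<Rightarrow> ('a list \<Rightarrow> real) set) \<Rightarrow> (nat \<Rightarrow> ('a list \<Rightarrow> real) set) \<Rightarrow> bool" where
  "includes_assessment R A \<longleftrightarrow> (\<forall>n\<ge>1. A n \<subseteq> R n)"

definition smallest_family_including ::
    "(nat \<Rightarrow> ('a list \<Rightarrow> real) set) \<Rightarrow> (nat \<Rightarrow> ('a list \<Rightarrow> real) set) \<Rightarrow> bool" where
  "smallest_family_including A R \<longleftrightarrow>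
     coherent_exch_tc_family R \<and> includes_assessment R A \<and>
     (\<forall>S. coherent_exch_tc_family S \<and> includes_assessment S A \<longrightarrow> (\<forall>n\<ge>1. R n \<subseteq> S n))"

definition count_vectors :: "nat \<Rightarrow> ('a::finite \<Rightarrow> nat) set" where
  "count_vectors n = {m. (\<Sum>z\<in>UNIV. m z) = n}"

definition atom :: "('a::finite \<Rightarrow> nat) \<Rightarrow> 'a list set" where
  "atom m = {x. \<forall>z. count_list x z = m z}"

definition simplex :: "('a::finite \<Rightarrow> real) set" where
  "simplex = {\<theta>. (\<forall>x. 0 \<le> \<theta> x) \<and> (\<Sum>x\<in>UNIV. \<theta> x) = 1}"

text \<open>
  A real polynomial in the variables \<open>\<theta> z\<close> is a finitely supported map from multi-indices to
  coefficients; the zero polynomial has degree 0.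
\<close>

type_synonym 'a mpoly = "('a \<Rightarrow> nat) \<Rightarrow>\<^sub>0 real"

definition mpoly_eval :: "'a::finite mpoly \<Rightarrow> ('a \<Rightarrow> real) \<Rightarrow> real" where
  "mpoly_eval q \<theta> =
     (\<Sum>m\<in>Poly_Mapping.keys q. Poly_Mapping.lookup q m * (\<Prod>z\<in>UNIV. \<theta> z ^ m z))"

definition mpoly_degree :: "'a::finite mpoly \<Rightarrow> nat" where
  "mpoly_degree q = Max (insert 0 ((\<lambda>m. \<Sum>z\<in>UNIV. m z) ` Poly_Mapping.keys q))"

definition represents :: "'a::finite mpoly \<Rightarrow> (('a \<Rightarrow> real) \<Rightarrow> real) \<Rightarrow> bool" where
  "represents q p \<longleftrightarrow> (\<forall>\<theta>\<in>simplex. p \<theta> = mpoly_eval q \<theta>)"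

definition polys :: "(('a::finite \<Rightarrow> real) \<Rightarrow> real) set" where
  "polys = {p. (\<exists>q. represents q p) \<and> (\<forall>\<theta>. \<theta> \<notin> simplex \<longrightarrow> p \<theta> = 0)}"

definition deg :: "(('a::finite \<Rightarrow> real) \<Rightarrow> real) \<Rightarrow> nat" where
  "deg p = (LEAST d. \<exists>q. represents q p \<and> mpoly_degree q = d)"

definition bernstein :: "('a::finite \<Rightarrow> nat) \<Rightarrow> ('a \<Rightarrow> real) \<Rightarrow> real" where
  "bernstein m \<theta> =
     (if \<theta> \<in> simplex then real (card (atom m)) * (\<Prod>z\<in>UNIV. \<theta> z ^ m z) else 0)"

text \<open>For \<open>p \<in> polys\<close> and \<open>n \<ge> deg p\<close> there is exactly one such coefficient gamble.\<close>

definition bern_coeff ::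
    "nat \<Rightarrow> (('a::finite \<Rightarrow> real) \<Rightarrow> real) \<Rightarrow> ('a \<Rightarrow> nat) \<Rightarrow> real" where
  "bern_coeff n p =
     (THE b. b \<in> gambles (count_vectors n) \<and>
             p = (\<lambda>\<theta>. \<Sum>m\<in>count_vectors n. b m * bernstein m \<theta>))"

definition Mn ::
    "nat \<Rightarrow> ('a::finite list \<Rightarrow> real) \<Rightarrow> ('a \<Rightarrow> real) \<Rightarrow> real" where
  "Mn n f = (\<lambda>\<theta>. \<Sum>m\<in>count_vectors n.
     (1 / real (card (atom m)) * (\<Sum>y\<in>atom m. f y)) * bernstein m \<theta>)"

definition frequency_representation ::
    "(nat \<Rightarrow> ('a::finite list \<Rightarrow> real) set) \<Rightarrow> (('a \<Rightarrow> real) \<Rightarrow> real) set" where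
  "frequency_representation R = (\<Union>n\<in>{1..}. Mn n ` R n)"

definition posi :: "('b \<Rightarrow> real) set \<Rightarrow> ('b \<Rightarrow> real) set" where
  "posi H = {(\<lambda>x. \<Sum>k=1..n. c k * p k x) | (n::nat) c p.
     1 \<le> n \<and> (\<forall>k\<in>{1..n}. p k \<in> H \<and> 0 < c k)}"

definition avoids_bernstein_nonpositivity ::
    "(('a::finite \<Rightarrow> real) \<Rightarrow> real) set \<Rightarrow> bool" where
  "avoids_bernstein_nonpositivity H \<longleftrightarrow>
     \<not> (\<exists>p\<in>posi H. \<exists>n\<ge>deg p. bern_coeff n p \<le> (\<lambda>_. 0))"

definition bernstein_coherent :: "(('a::finite \<Rightarrow> real) \<Rightarrow> real) set \<Rightarrow> bool" where
  "bernstein_coherent H \<longleftrightarrow>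
     H \<subseteq> polys \<and>
     (\<lambda>_. 0) \<notin> H \<and>
     (\<forall>p\<in>polys. (\<exists>n\<ge>deg p. (\<lambda>_. 0) < bern_coeff n p) \<longrightarrow> p \<in> H) \<and>
     (\<forall>p\<in>H. \<forall>c>0. (\<lambda>\<theta>. c * p \<theta>) \<in> H) \<and>
     (\<forall>p1\<in>H. \<forall>p2\<in>H. (\<lambda>\<theta>. p1 \<theta> + p2 \<theta>) \<in> H)"

definition bernstein_natural_extension ::
    "(('a::finite \<Rightarrow> real) \<Rightarrow> real) set \<Rightarrow> (('a \<Rightarrow> real) \<Rightarrow> real) set" where
  "bernstein_natural_extension H =
     (if \<exists>K. bernstein_coherent K \<and> H \<subseteq> K
      then \<Inter>{K. bernstein_coherent K \<and> H \<subseteq> K}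
      else polys)"

end

theory Submission
  imports Defs
begin

text \<open>
  On the simplex, \<open>Mn n f \<theta>\<close> is the expectation of \<open>f\<close> under \<open>n\<close> independent draws from \<open>\<theta>\<close>. Hence
  \<open>Mn\<close> is invariant under \<open>ext\<close> and under permutations of the positions, and linear independence of
  the monomials of degree \<open>n\<close> shows that two gambles with the same image differ by a gamble that
  sums to zero over every atom, that is, by a sum of gambles of the form \<open>f - f \<circ> \<pi>\<close>. So \<open>R\<close> is
  recovered from its frequency representation \<open>H\<close> as \<open>R n = {f. Mn n f \<in> H}\<close>, and this is an order
  isomorphism between coherent, exchangeable and time-consistent families and Bernstein coherent
  sets. It turns the theorem into the statement about cones that \<open>posi P\<close> together with the
  Bernstein non-negative polynomials generates a Bernstein coherent set iff no element of
  \<open>posi P\<close> is Bernstein non-positive.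
\<close>

subsection \<open>Linear independence of monomials\<close>

text \<open>Induction on the set of variables. With the other variables fixed at positive values,
  the sum is a polynomial in the variable \<open>s\<close> that vanishes at every positive real, so
  each of its coefficients vanishes. The coefficient belonging to the exponent \<open>m s\<close> is
  a sum over fewer variables, to which the induction hypothesis applies.\<close>

lemma monomials_independent:
  fixes c :: "('a \<Rightarrow> nat) \<Rightarrow> real"
  assumes "finite S" and "finite M"
    and "\<And>m m'. m \<in> M \<Longrightarrow> m' \<in> M \<Longrightarrow> (\<And>z. z \<in> S \<Longrightarrow> m z = m' z) \<Longrightarrow> m = m'"
    and "\<And>\<theta>. (\<And>z. 0 < \<theta> z) \<Longrightarrow> (\<Sum>m\<in>M. c m * (\<Prod>z\<in>S. \<theta> z ^ m z)) = 0"
    and "m \<in> M"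
  shows "c m = 0"
  using assms
proof (induction S arbitrary: M rule: finite_induct)
  case empty
  have "M = {m}"
    using empty.prems(2,4) by blast
  then show ?case
    using empty.prems(3)[of "\<lambda>_. 1"] by simp
next
  case (insert s S)
  define M' where "M' = {l \<in> M. l s = m s}"
  show ?case
  proof (rule insert.IH[of M'])
    show "finite M'" "m \<in> M'"
      using insert.prems(1,4) by (simp_all add: M'_def)
    show "l = l'" if "l \<in> M'" "l' \<in> M'" "\<And>z. z \<in> S \<Longrightarrow> l z = l' z" for l l'
      using that by (intro insert.prems(2)) (auto simp: M'_def)
    show "(\<Sum>l\<in>M'. c l * (\<Prod>z\<in>S. \<theta> z ^ l z)) = 0" if pos: "\<And>z. 0 < \<theta> z" for \<theta>
    proof (rule ccontr)
      \<comment> \<open>For fixed \<open>\<theta>\<close>, \<open>d k\<close> is the coefficient of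
        \<open>t ^ k\<close> after setting the variable \<open>s\<close> to \<open>t\<close>, and
        \<open>d (m s)\<close> is the sum supposed to be non-zero. \<open>N\<close> bounds the
        exponents of \<open>s\<close>.\<close>
      define d where "d k = (\<Sum>l\<in>{l \<in> M. l s = k}. c l * (\<Prod>z\<in>S. \<theta> z ^ l z))" for k
      define N where "N = Max ((\<lambda>l. l s) ` M)"
      assume "(\<Sum>l\<in>M'. c l * (\<Prod>z\<in>S. \<theta> z ^ l z)) \<noteq> 0"
      then have "d (m s) \<noteq> 0"
        by (simp add: d_def M'_def)
      moreover have le_N: "l s \<le> N" if "l \<in> M" for l
        using that insert.prems(1) by (simp add: N_def)
      ultimately have "finite {t. (\<Sum>k\<le>N. d k * t ^ k) = 0}"
        using polyfun_finite_roots[of d "N"] insert.prems(4) by blast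
      moreover have "{0<..} \<subseteq> {t. (\<Sum>k\<le>N. d k * t ^ k) = 0}"
      proof clarsimp
        fix t :: real
        assume "0 < t"
        have "(\<Sum>k\<le>N. d k * t ^ k)
            = (\<Sum>k\<le>N. \<Sum>l\<in>{l \<in> M. l s = k}. c l * (\<Prod>z\<in>S. \<theta> z ^ l z) * t ^ l s)"
          by (simp add: d_def sum_distrib_right)
        also have "\<dots> = (\<Sum>l\<in>M. c l * (\<Prod>z\<in>S. \<theta> z ^ l z) * t ^ l s)"
          using insert.prems(1) le_N by (intro sum.group) auto
        also have "\<dots> = (\<Sum>l\<in>M. c l * (\<Prod>z\<in>insert s S. (\<theta>(s := t)) z ^ l z))"
        proof (rule sum.cong[OF refl])
          fix l
          have "(\<Prod>z\<in>S. (\<theta>(s := t)) z ^ l z) = (\<Prod>z\<in>S. \<theta> z ^ l z)"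
            using insert.hyps by (intro prod.cong) auto
          then show "c l * (\<Prod>z\<in>S. \<theta> z ^ l z) * t ^ l s
              = c l * (\<Prod>z\<in>insert s S. (\<theta>(s := t)) z ^ l z)"
            using insert.hyps by simp
        qed
        also have "\<dots> = 0"
          using pos \<open>0 < t\<close> by (intro insert.prems(3)) auto
        finally show "(\<Sum>k\<le>N. d k * t ^ k) = 0" .
      qed
      ultimately show False
        using finite_subset infinite_Ioi by blast
    qed
  qed
qed

section \<open>Tuples, atoms and count vectors\<close>

lemma finite_tuples [simp]: "finite (tuples n :: 'a::finite list set)"
  using finite_lists_length_eq[of "UNIV :: 'a set" n] by (simp add: tuples_def)

lemma gambles_finite: "finite \<Omega> \<Longrightarrow> gambles \<Omega> = {f. \<forall>x. x \<notin> \<Omega> \<longrightarrow> f x = 0}"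
  by (auto simp: gambles_def finite_imp_bounded)

lemma count_list_in_count_vectors [simp]:
  fixes x :: "'a::finite list"
  shows "count_list x \<in> count_vectors n \<longleftrightarrow> x \<in> tuples n"
  by (simp add: count_vectors_def tuples_def sum_count_set)

lemma atom_alt: "atom m = {x. count_list x = m}"
  by (auto simp: atom_def)

lemma atom_subset_tuples: "m \<in> count_vectors n \<Longrightarrow> atom m \<subseteq> tuples n"
  by (auto simp: atom_alt)

text \<open>Over a finite alphabet \<open>m\<close> is the multiplicity function of a multiset, and
  any listing of that multiset lies in the atom.\<close>

lemma atom_nonempty: "atom (m :: 'a::finite \<Rightarrow> nat) \<noteq> {}"
proof -
  obtain x where "mset x = Abs_multiset m"
    using ex_mset by blast
  then have "count_list x = m"
    by (metis Abs_multiset_inverse count_mset finite_code mem_Collect_eq ext)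
  then show ?thesis
    by (auto simp: atom_alt)
qed

lemma count_vectors_eq: "count_vectors n = count_list ` (tuples n :: 'a::finite list set)"
proof -
  have "m \<in> count_list ` tuples n" if "m \<in> count_vectors n" for m :: "'a \<Rightarrow> nat"
    using that atom_nonempty[of m] atom_subset_tuples[OF that] by (auto simp: atom_alt)
  then show ?thesis
    by auto
qed

lemma finite_count_vectors [simp]: "finite (count_vectors n :: ('a::finite \<Rightarrow> nat) set)"
  by (simp add: count_vectors_eq)

text \<open>All monomials have the same degree \<open>n\<close>, so dividing a positive point by its
  coordinate sum \<open>s\<close> only changes the sum by the factor \<open>1 / s ^ n\<close>.
  Vanishing on the simplex thus gives vanishing at all positive points.\<close>

lemma monomials_independent_simplex:
  fixes c :: "('a::finite \<Rightarrow> nat) \<Rightarrow> real"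
  assumes zero: "\<And>\<theta>. \<theta> \<in> simplex \<Longrightarrow> (\<Sum>m\<in>count_vectors n. c m * (\<Prod>z\<in>UNIV. \<theta> z ^ m z)) = 0"
    and "m \<in> count_vectors n"
  shows "c m = 0"
proof (rule monomials_independent[of UNIV "count_vectors n"])
  fix \<theta> :: "'a \<Rightarrow> real"
  assume pos: "\<And>z. 0 < \<theta> z"
  define s where "s = sum \<theta> UNIV"
  have "0 < s"
    unfolding s_def using pos by (intro sum_pos) auto
  then have "(\<lambda>z. \<theta> z / s) \<in> simplex"
    using pos by (auto simp: simplex_def s_def less_imp_le simp flip: sum_divide_distrib)
  then have "0 = (\<Sum>m\<in>count_vectors n. c m * (\<Prod>z\<in>UNIV. (\<theta> z / s) ^ m z))"
    using zero by simp
  also have "\<dots> = (\<Sum>m\<in>count_vectors n. c m * (\<Prod>z\<in>UNIV. \<theta> z ^ m z)) / s ^ n"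
    unfolding sum_divide_distrib
    by (intro sum.cong)
      (simp_all add: power_divide prod_dividef count_vectors_def flip: power_sum)
  finally show "(\<Sum>m\<in>count_vectors n. c m * (\<Prod>z\<in>UNIV. \<theta> z ^ m z)) = 0"
    using \<open>0 < s\<close> by simp
qed (use assms in auto)

lemma card_atom_pos: "m \<in> count_vectors n \<Longrightarrow> 0 < card (atom (m :: 'a::finite \<Rightarrow> nat))"
  by (meson atom_nonempty atom_subset_tuples card_gt_0_iff finite_subset finite_tuples)

text \<open>The fibres of \<open>count_list\<close> partition \<open>tuples n\<close>, and these
  fibres are the atoms.\<close>

lemma sum_tuples_by_atom:
  fixes f :: "'a::finite list \<Rightarrow> real"
  shows "(\<Sum>m\<in>count_vectors n. \<Sum>x\<in>atom m. f x) = (\<Sum>x\<in>tuples n. f x)"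
proof -
  have "(\<Sum>m\<in>count_vectors n. \<Sum>x\<in>atom m. f x)
      = (\<Sum>m\<in>count_vectors n. \<Sum>x\<in>{x \<in> tuples n. count_list x = m}. f x)"
    by (intro sum.cong) (auto simp: atom_alt)
  also have "\<dots> = (\<Sum>x\<in>tuples n. f x)"
    by (intro sum.group) auto
  finally show ?thesis .
qed

text \<open>Identifies a monomial with the probability of a tuple under independent draws; this
  probability depends on the counts alone.\<close>

lemma prod_power_count_list:
  fixes \<theta> :: "'a::finite \<Rightarrow> real"
  shows "(\<Prod>z\<in>UNIV. \<theta> z ^ count_list x z) = prod_list (map \<theta> x)"
proof (induction x)
  case (Cons a x)
  have "(\<Prod>z\<in>UNIV. \<theta> z ^ count_list (a # x) z)
      = (\<Prod>z\<in>UNIV. (if a = z then \<theta> z else 1) * \<theta> z ^ count_list x z)"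
    by (intro prod.cong) auto
  also have "\<dots> = \<theta> a * (\<Prod>z\<in>UNIV. \<theta> z ^ count_list x z)"
    by (simp add: prod.distrib)
  finally show ?case
    using Cons.IH by simp
qed simp

subsection \<open>The map \<open>Mn\<close> as an expectation\<close>

text \<open>All tuples of an atom have the same weight, and the factor \<open>card (atom m)\<close>
  in \<open>bernstein m\<close> cancels the division in the average of \<open>f\<close>.\<close>

lemma Mn_simplex:
  fixes f :: "'a::finite list \<Rightarrow> real"
  assumes "\<theta> \<in> simplex"
  shows "Mn n f \<theta> = (\<Sum>x\<in>tuples n. f x * prod_list (map \<theta> x))"
proof -
  have "Mn n f \<theta> = (\<Sum>m\<in>count_vectors n. \<Sum>x\<in>atom m. f x * prod_list (map \<theta> x))"
    unfolding Mn_def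
  proof (rule sum.cong[OF refl])
    fix m :: "'a \<Rightarrow> nat"
    assume m: "m \<in> count_vectors n"
    have "1 / real (card (atom m)) * (\<Sum>y\<in>atom m. f y) * bernstein m \<theta>
        = (\<Sum>x\<in>atom m. f x * (\<Prod>z\<in>UNIV. \<theta> z ^ m z))"
      using card_atom_pos[OF m] assms by (simp add: bernstein_def flip: sum_distrib_right)
    also have "\<dots> = (\<Sum>x\<in>atom m. f x * prod_list (map \<theta> x))"
      by (intro sum.cong) (auto simp: atom_alt simp flip: prod_power_count_list)
    finally show "1 / real (card (atom m)) * (\<Sum>y\<in>atom m. f y) * bernstein m \<theta>
        = (\<Sum>x\<in>atom m. f x * prod_list (map \<theta> x))" .
  qed
  then show ?thesis
    by (simp add: sum_tuples_by_atom)
qed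

lemma Mn_outside: "\<theta> \<notin> simplex \<Longrightarrow> Mn n f \<theta> = 0"
  by (simp add: Mn_def bernstein_def)

lemma Mn_eq:
  "Mn n f = (\<lambda>\<theta>. if \<theta> \<in> simplex then \<Sum>x\<in>tuples n. f x * prod_list (map \<theta> x) else 0)"
  by (auto simp: Mn_simplex Mn_outside)

lemma Mn_zero: "Mn n (\<lambda>_. 0) = (\<lambda>_. 0)"
  by (simp add: Mn_def)

lemma Mn_add: "Mn n (\<lambda>x. f x + g x) = (\<lambda>\<theta>. Mn n f \<theta> + Mn n g \<theta>)"
  by (auto simp: Mn_eq sum.distrib distrib_right)

lemma Mn_scale: "Mn n (\<lambda>x. c * f x) = (\<lambda>\<theta>. c * Mn n f \<theta>)"
  by (auto simp: Mn_eq sum_distrib_left mult.assoc)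

lemma Mn_diff: "Mn n (\<lambda>x. f x - g x) = (\<lambda>\<theta>. Mn n f \<theta> - Mn n g \<theta>)"
  by (auto simp: Mn_eq sum_subtractf left_diff_distrib)

lemma Mn_uminus: "Mn n (\<lambda>x. - f x) = (\<lambda>\<theta>. - Mn n f \<theta>)"
  by (auto simp: Mn_eq sum_negf)

lemma Mn_sum:
  fixes f :: "'b \<Rightarrow> 'a::finite list \<Rightarrow> real"
  shows "Mn n (\<lambda>x. \<Sum>i\<in>I. f i x) = (\<lambda>\<theta>. \<Sum>i\<in>I. Mn n (f i) \<theta>)"
proof (induction I rule: infinite_finite_induct)
  case (insert i I)
  then show ?case by (simp add: Mn_add)
qed (simp_all add: Mn_zero)

text \<open>Expanding the power means choosing one summand from each factor, that is, choosing a
  tuple. On the simplex the weights of the tuples therefore add up to 1.\<close>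

lemma sum_prod_list_tuples:
  "(\<Sum>x\<in>tuples n. prod_list (map \<theta> x)) = (\<Sum>z\<in>UNIV. \<theta> z) ^ n" for \<theta> :: "'a::finite \<Rightarrow> real"
proof (induction n)
  case 0
  then show ?case by (simp add: tuples_def)
next
  case (Suc n)
  have bij: "bij_betw (\<lambda>(z, x). z # x) (UNIV \<times> tuples n) (tuples (Suc n) :: 'a list set)"
    by (rule bij_betwI[where g = "\<lambda>x. (hd x, tl x)"]) (auto simp: tuples_def length_Suc_conv)
  have "(\<Sum>x\<in>tuples (Suc n). prod_list (map \<theta> x))
      = (\<Sum>(z, x)\<in>UNIV \<times> tuples n. \<theta> z * prod_list (map \<theta> x))"
    by (subst sum.reindex_bij_betw[OF bij, symmetric]) (simp add: case_prod_unfold)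
  also have "\<dots> = (\<Sum>z\<in>UNIV. \<theta> z) * (\<Sum>x\<in>tuples n. prod_list (map \<theta> x))"
    by (simp add: sum_product sum.cartesian_product)
  finally show ?case
    using Suc.IH by simp
qed

lemma bij_betw_append_tuples:
  "n1 \<le> n2 \<Longrightarrow> bij_betw (\<lambda>(x, y). x @ y) (tuples n1 \<times> tuples (n2 - n1)) (tuples n2)"
  by (rule bij_betwI[where g = "\<lambda>x. (take n1 x, drop n1 x)"]) (auto simp: tuples_def)

text \<open>A tuple splits into a prefix, on which the gamble depends, and a suffix. The weight is
  the product of both weights, and those of the suffixes sum to 1.\<close>

lemma Mn_ext:
  fixes f :: "'a::finite list \<Rightarrow> real"
  assumes "n1 \<le> n2"
  shows "Mn n2 (ext n1 n2 f) = Mn n1 f"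
proof
  fix \<theta> :: "'a \<Rightarrow> real"
  show "Mn n2 (ext n1 n2 f) \<theta> = Mn n1 f \<theta>"
  proof (cases "\<theta> \<in> simplex")
    case True
    have "Mn n2 (ext n1 n2 f) \<theta> = (\<Sum>x\<in>tuples n2. f (take n1 x) * prod_list (map \<theta> x))"
      using True by (simp add: Mn_simplex ext_def)
    also have "\<dots> = (\<Sum>(x, y)\<in>tuples n1 \<times> tuples (n2 - n1).
        f x * prod_list (map \<theta> x) * prod_list (map \<theta> y))"
      by (subst sum.reindex_bij_betw[OF bij_betw_append_tuples[OF assms], symmetric])
        (auto intro!: sum.cong simp: tuples_def)
    also have "\<dots> = (\<Sum>x\<in>tuples n1. f x * prod_list (map \<theta> x))
        * (\<Sum>y\<in>tuples (n2 - n1). prod_list (map \<theta> y))"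
      by (simp add: sum_product sum.cartesian_product)
    also have "\<dots> = Mn n1 f \<theta>"
      using True by (simp add: sum_prod_list_tuples Mn_simplex) (simp add: simplex_def)
    finally show ?thesis .
  qed (simp add: Mn_outside)
qed

lemma bij_betw_permute_list_tuples:
  assumes "\<pi> permutes {..<n}"
  shows "bij_betw (permute_list \<pi>) (tuples n) (tuples n)"
proof (rule bij_betwI[where g = "permute_list (inv \<pi>)"])
  have "inv \<pi> permutes {..<n}"
    using assms by (rule permutes_inv)
  then show "permute_list (inv \<pi>) (permute_list \<pi> x) = x"
    "permute_list \<pi> (permute_list (inv \<pi>) x) = x" if "x \<in> tuples n" for x :: "'a list"
    using that assms
    by (simp_all add: tuples_def permutes_inv_o flip: permute_list_compose)
qed (auto simp: tuples_def)

text \<open>Rearranging a tuple keeps its weight, since the weight is a product over its multiset of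
  entries.\<close>

lemma Mn_permute:
  fixes f :: "'a::finite list \<Rightarrow> real"
  assumes "\<pi> permutes {..<n}"
  shows "Mn n (\<lambda>x. f (permute_list \<pi> x)) = Mn n f"
proof
  fix \<theta> :: "'a \<Rightarrow> real"
  have weight: "prod_list (map \<theta> (permute_list \<pi> x)) = prod_list (map \<theta> x)"
    if "x \<in> tuples n" for x
  proof -
    have "mset (map \<theta> (permute_list \<pi> x)) = mset (map \<theta> x)"
      using assms that by (simp add: tuples_def)
    then show ?thesis
      by (metis prod_mset_prod_list)
  qed
  show "Mn n (\<lambda>x. f (permute_list \<pi> x)) \<theta> = Mn n f \<theta>"
  proof (cases "\<theta> \<in> simplex")
    case True
    have "(\<Sum>x\<in>tuples n. f (permute_list \<pi> x) * prod_list (map \<theta> x))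
        = (\<Sum>x\<in>tuples n. f (permute_list \<pi> x) * prod_list (map \<theta> (permute_list \<pi> x)))"
      by (simp add: weight)
    also have "\<dots> = (\<Sum>x\<in>tuples n. f x * prod_list (map \<theta> x))"
      by (rule sum.reindex_bij_betw[OF bij_betw_permute_list_tuples[OF assms]])
    finally show ?thesis
      using True by (simp add: Mn_simplex)
  qed (simp add: Mn_outside)
qed

section \<open>Order, gambles and extension to longer tuples\<close>

lemma zero_less_fun_iff:
  fixes f :: "'b \<Rightarrow> real"
  shows "(\<lambda>_. 0) < f \<longleftrightarrow> (\<forall>x. 0 \<le> f x) \<and> (\<exists>x. 0 < f x)"
  unfolding less_le[of "\<lambda>_. 0" f] le_fun_def fun_eq_iff by (force simp: less_le)

lemma gambles_tuples:
  fixes f :: "'a::finite list \<Rightarrow> real"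
  shows "f \<in> gambles (tuples n) \<longleftrightarrow> (\<forall>x. x \<notin> tuples n \<longrightarrow> f x = 0)"
  by (simp add: gambles_finite)

lemma gambles_count_vectors:
  fixes b :: "('a::finite \<Rightarrow> nat) \<Rightarrow> real"
  shows "b \<in> gambles (count_vectors n) \<longleftrightarrow> (\<forall>m. m \<notin> count_vectors n \<longrightarrow> b m = 0)"
  by (simp add: gambles_finite)

lemma ext_in_gambles:
  fixes f :: "'a::finite list \<Rightarrow> real"
  shows "ext n1 n2 f \<in> gambles (tuples n2)"
  by (simp add: gambles_tuples ext_def)

lemma ext_append:
  assumes "x \<in> tuples n1" and "n1 \<le> n2"
  shows "ext n1 n2 f (x @ replicate (n2 - n1) a) = f x"
  using assms by (simp add: ext_def tuples_def)

lemma inj_on_ext: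
  assumes "n1 \<le> n2"
  shows "inj_on (ext n1 n2) (gambles (tuples n1) :: ('a::finite list \<Rightarrow> real) set)"
proof (rule inj_onI, rule HOL.ext)
  fix f g :: "'a list \<Rightarrow> real" and x
  assume "f \<in> gambles (tuples n1)" "g \<in> gambles (tuples n1)" "ext n1 n2 f = ext n1 n2 g"
  then show "f x = g x"
    using ext_append[OF _ assms, of x] by (cases "x \<in> tuples n1") (metis, simp add: gambles_tuples)
qed

lemma ext_nonneg: "(\<lambda>_. 0) \<le> f \<Longrightarrow> (\<lambda>_. 0) \<le> ext n1 n2 f"
  by (simp add: ext_def le_fun_def)

lemma ext_pos:
  fixes f :: "'a::finite list \<Rightarrow> real"
  assumes "n1 \<le> n2" and "f \<in> gambles (tuples n1)" and "(\<lambda>_. 0) < f"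
  shows "(\<lambda>_. 0) < ext n1 n2 f"
proof -
  obtain x where x: "0 < f x" and nonneg: "\<forall>x. 0 \<le> f x"
    using assms(3) by (auto simp: zero_less_fun_iff)
  then have "x \<in> tuples n1"
    using assms(2) by (force simp: gambles_tuples)
  \<comment> \<open>\<open>undefined\<close> stands for some letter of the alphabet; any padding
    restores the prefix \<open>x\<close>.\<close>
  then have "0 < ext n1 n2 f (x @ replicate (n2 - n1) undefined)"
    using ext_append assms(1) x by metis
  moreover have "0 \<le> ext n1 n2 f y" for y
    using nonneg by (simp add: ext_def)
  ultimately show ?thesis
    unfolding zero_less_fun_iff by blast
qed

subsection \<open>Polynomials and Bernstein coefficients\<close>

text \<open>With \<open>card (atom m)\<close> cancelled, the image is a homogeneous form of degree
  \<open>n\<close> whose coefficients are the sums of \<open>f\<close> over atoms. A representing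
  polynomial is read off from this form.\<close>

lemma Mn_monomials:
  fixes f :: "'a::finite list \<Rightarrow> real"
  assumes "\<theta> \<in> simplex"
  shows "Mn n f \<theta> = (\<Sum>m\<in>count_vectors n. (\<Sum>y\<in>atom m. f y) * (\<Prod>z\<in>UNIV. \<theta> z ^ m z))"
  unfolding Mn_def
proof (rule sum.cong[OF refl])
  fix m :: "'a \<Rightarrow> nat"
  assume "m \<in> count_vectors n"
  from card_atom_pos[OF this] show "1 / real (card (atom m)) * (\<Sum>y\<in>atom m. f y) * bernstein m \<theta>
      = (\<Sum>y\<in>atom m. f y) * (\<Prod>z\<in>UNIV. \<theta> z ^ m z)"
    using assms by (simp add: bernstein_def)
qed

text \<open>The exponents that occur all have total degree \<open>n\<close>; the degree may still be
  smaller, because the sums over all atoms may vanish.\<close>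

lemma Mn_represents:
  fixes f :: "'a::finite list \<Rightarrow> real"
  obtains q where "represents q (Mn n f)" and "mpoly_degree q \<le> n"
proof -
  define c where "c m = (if m \<in> count_vectors n then \<Sum>y\<in>atom m. f y else 0)" for m
  define q where "q = Abs_poly_mapping c"
  have "finite {m. c m \<noteq> 0}"
    by (rule finite_subset[OF _ finite_count_vectors[of n]]) (auto simp: c_def)
  then have lookup: "Poly_Mapping.lookup q = c"
    by (simp add: q_def)
  have keys: "Poly_Mapping.keys q \<subseteq> count_vectors n"
    by (auto simp: in_keys_iff lookup c_def split: if_splits)
  have "mpoly_eval q \<theta> = Mn n f \<theta>" if "\<theta> \<in> simplex" for \<theta>
  proof -
    have "mpoly_eval q \<theta> = (\<Sum>m\<in>count_vectors n. c m * (\<Prod>z\<in>UNIV. \<theta> z ^ m z))"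
      unfolding mpoly_eval_def lookup
      using keys by (intro sum.mono_neutral_left) (auto simp: in_keys_iff lookup)
    then show ?thesis
      using that by (simp add: Mn_monomials c_def)
  qed
  then have "represents q (Mn n f)"
    by (simp add: represents_def)
  moreover have "mpoly_degree q \<le> n"
    using keys by (auto simp: mpoly_degree_def count_vectors_def)
  ultimately show thesis
    by (rule that)
qed

lemma Mn_in_polys: "Mn n f \<in> polys"
  using Mn_represents[of n f] by (auto simp: polys_def Mn_outside)

lemma deg_Mn_le: "deg (Mn n f) \<le> n"
proof -
  obtain q where "represents q (Mn n f)" "mpoly_degree q \<le> n"
    by (rule Mn_represents)
  then show ?thesis
    unfolding deg_def by (metis (mono_tags, lifting) Least_le order_trans)
qed

lemma Mn_indicator:
  fixes x :: "'a::finite list"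
  assumes "x \<in> tuples n" and "\<theta> \<in> simplex"
  shows "Mn n (\<lambda>y. if y = x then 1 else 0) \<theta> = prod_list (map \<theta> x)"
  using assms by (simp add: Mn_simplex if_distrib[of "\<lambda>c. c * _"] cong: if_cong)

text \<open>
  A monomial of degree \<open>k \<le> n\<close> is the expectation of the indicator of a tuple of length \<open>k\<close>,
  so extending the indicator to \<open>n\<close>-tuples performs the degree elevation.
\<close>

lemma polys_eq_Mn:
  fixes p :: "('a::finite \<Rightarrow> real) \<Rightarrow> real"
  assumes "p \<in> polys" and "deg p \<le> n"
  obtains f where "f \<in> gambles (tuples n)" and "p = Mn n f"
proof -
  have "\<exists>d q. represents q p \<and> mpoly_degree q = d"
    using assms(1) by (simp add: polys_def)
  then have "\<exists>q. represents q p \<and> mpoly_degree q = deg p"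
    unfolding deg_def by (rule LeastI_ex)
  then obtain q where q: "represents q p" "mpoly_degree q = deg p"
    by blast
  define k where "k m = (\<Sum>z\<in>UNIV. m z)" for m :: "'a \<Rightarrow> nat"
  \<comment> \<open>Any tuple with counts \<open>m\<close> serves, since its weight is the monomial
    with exponents \<open>m\<close>.\<close>
  define w where "w m = (SOME x. x \<in> atom m)" for m :: "'a \<Rightarrow> nat"
  have w: "count_list (w m) = m" for m
    using atom_nonempty[of m] someI_ex[of "\<lambda>x. x \<in> atom m"] by (auto simp: w_def atom_alt)
  have w_tuple: "w m \<in> tuples (k m)" for m
    using count_list_in_count_vectors[of "w m" "k m"] by (simp add: w count_vectors_def k_def)
  have k_le: "k m \<le> n" if "m \<in> Poly_Mapping.keys q" for m
  proof -
    have "k m \<le> mpoly_degree q"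
      using that unfolding mpoly_degree_def k_def by (intro Max_ge) auto
    then show ?thesis
      using q(2) assms(2) by simp
  qed
  define f where "f x = (\<Sum>m\<in>Poly_Mapping.keys q. Poly_Mapping.lookup q m *
    ext (k m) n (\<lambda>y. if y = w m then 1 else 0) x)" for x
  have "f \<in> gambles (tuples n)"
    by (simp add: gambles_tuples f_def ext_def)
  moreover have "p \<theta> = Mn n f \<theta>" for \<theta>
  proof (cases "\<theta> \<in> simplex")
    case True
    have "p \<theta> = (\<Sum>m\<in>Poly_Mapping.keys q. Poly_Mapping.lookup q m * (\<Prod>z\<in>UNIV. \<theta> z ^ m z))"
      using q(1) True by (simp add: represents_def mpoly_eval_def)
    also have "\<dots> = (\<Sum>m\<in>Poly_Mapping.keys q. Poly_Mapping.lookup q m *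
        Mn (k m) (\<lambda>y. if y = w m then 1 else 0) \<theta>)"
      by (simp add: Mn_indicator[OF w_tuple True] w flip: prod_power_count_list)
    also have "\<dots> = Mn n f \<theta>"
      unfolding f_def Mn_sum Mn_scale by (simp add: Mn_ext k_le)
    finally show ?thesis .
  next
    case False
    then show ?thesis
      using assms(1) by (simp add: polys_def Mn_outside)
  qed
  ultimately show thesis
    using that by blast
qed

text \<open>A gamble that is constant on atoms coincides on each of them with its average there.
  Hence every Bernstein expansion is the image of its coefficients, read as a gamble on
  tuples.\<close>

lemma Mn_count_list:
  fixes b :: "('a::finite \<Rightarrow> nat) \<Rightarrow> real"
  shows "Mn n (\<lambda>x. b (count_list x)) = (\<lambda>\<theta>. \<Sum>m\<in>count_vectors n. b m * bernstein m \<theta>)"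
  unfolding Mn_def
proof (intro HOL.ext sum.cong[OF refl])
  fix m :: "'a \<Rightarrow> nat" and \<theta>
  assume "m \<in> count_vectors n"
  moreover have "(\<Sum>y\<in>atom m. b (count_list y)) = real (card (atom m)) * b m"
    by (simp add: atom_alt)
  ultimately show "1 / real (card (atom m)) * (\<Sum>y\<in>atom m. b (count_list y)) * bernstein m \<theta>
      = b m * bernstein m \<theta>"
    using card_atom_pos[of m n] by simp
qed

text \<open>Two expansions of \<open>p\<close> differ by a vanishing combination of monomials with
  coefficients \<open>(b' m - b m) * card (atom m)\<close>, and linear independence makes these
  zero. This is the uniqueness behind the definite description in \<open>bern_coeff\<close>.\<close>

lemma bern_coeff_eqI:
  fixes b :: "('a::finite \<Rightarrow> nat) \<Rightarrow> real"
  assumes "b \<in> gambles (count_vectors n)"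
    and "p = (\<lambda>\<theta>. \<Sum>m\<in>count_vectors n. b m * bernstein m \<theta>)"
  shows "bern_coeff n p = b"
  unfolding bern_coeff_def
proof (rule the_equality)
  fix b'
  assume b': "b' \<in> gambles (count_vectors n) \<and>
    p = (\<lambda>\<theta>. \<Sum>m\<in>count_vectors n. b' m * bernstein m \<theta>)"
  have "b' m = b m" if m: "m \<in> count_vectors n" for m
  proof -
    have "(b' m - b m) * real (card (atom m)) = 0"
    proof (rule monomials_independent_simplex[OF _ m])
      fix \<theta> :: "'a \<Rightarrow> real"
      assume "\<theta> \<in> simplex"
      moreover have "(\<Sum>m\<in>count_vectors n. b' m * bernstein m \<theta>)
          = (\<Sum>m\<in>count_vectors n. b m * bernstein m \<theta>)"
        using assms(2) b' by metis
      ultimately show "(\<Sum>m\<in>count_vectors n.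
          (b' m - b m) * real (card (atom m)) * (\<Prod>z\<in>UNIV. \<theta> z ^ m z)) = 0"
        by (simp add: bernstein_def left_diff_distrib sum_subtractf mult.assoc)
    qed
    then show ?thesis
      using card_atom_pos[OF m] by simp
  qed
  then show "b' = b"
    using assms(1) b' by (force simp: gambles_count_vectors)
qed (use assms in simp)

lemma bern_coeff_Mn:
  fixes f :: "'a::finite list \<Rightarrow> real"
  shows "bern_coeff n (Mn n f) =
    (\<lambda>m. if m \<in> count_vectors n then (\<Sum>y\<in>atom m. f y) / real (card (atom m)) else 0)"
  by (rule bern_coeff_eqI) (simp_all add: gambles_count_vectors Mn_def)

text \<open>Among the preimages of \<open>p\<close> under \<open>Mn n\<close> there is one that is
  constant on atoms. Degree elevation provides some preimage, whose atom averages are the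
  coefficients.\<close>

lemma bern_coeff_gamble:
  fixes p :: "('a::finite \<Rightarrow> real) \<Rightarrow> real"
  assumes "p \<in> polys" and "deg p \<le> n"
  shows "(\<lambda>x. bern_coeff n p (count_list x)) \<in> gambles (tuples n)"
    and "Mn n (\<lambda>x. bern_coeff n p (count_list x)) = p"
proof -
  obtain f where f: "p = Mn n f"
    using polys_eq_Mn[OF assms] by blast
  show "(\<lambda>x. bern_coeff n p (count_list x)) \<in> gambles (tuples n)"
    by (simp add: f bern_coeff_Mn gambles_tuples)
  show "Mn n (\<lambda>x. bern_coeff n p (count_list x)) = p"
    unfolding Mn_count_list unfolding f bern_coeff_Mn unfolding Mn_def by simp
qed

lemma bern_coeff_outside:
  fixes p :: "('a::finite \<Rightarrow> real) \<Rightarrow> real"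
  assumes "p \<in> polys" and "deg p \<le> n" and "m \<notin> count_vectors n"
  shows "bern_coeff n p m = 0"
  using polys_eq_Mn[OF assms(1,2)] assms(3) by (metis bern_coeff_Mn)

section \<open>Bernstein positivity through preimages under \<open>Mn\<close>\<close>

definition bernstein_positive :: "(('a::finite \<Rightarrow> real) \<Rightarrow> real) set" where
  "bernstein_positive = {Mn n f | n f. f \<in> gambles (tuples n) \<and> (\<lambda>_. 0) < f}"

definition bernstein_nonnegative :: "(('a::finite \<Rightarrow> real) \<Rightarrow> real) set" where
  "bernstein_nonnegative = {Mn n f | n f. f \<in> gambles (tuples n) \<and> (\<lambda>_. 0) \<le> f}"

text \<open>Coefficients lift to a gamble that is constant on atoms. Conversely, averaging over
  atoms preserves signs, and the atom of a tuple at which \<open>f\<close> is positive has a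
  positive average.\<close>

lemma bernstein_positive_iff:
  fixes p :: "('a::finite \<Rightarrow> real) \<Rightarrow> real"
  assumes p: "p \<in> polys"
  shows "(\<exists>n\<ge>deg p. (\<lambda>_. 0) < bern_coeff n p) \<longleftrightarrow> p \<in> bernstein_positive"
proof
  assume "\<exists>n\<ge>deg p. (\<lambda>_. 0) < bern_coeff n p"
  then obtain n where n: "deg p \<le> n" "(\<lambda>_. 0) < bern_coeff n p"
    by blast
  then obtain m where m: "bern_coeff n p m > 0" "\<And>m. 0 \<le> bern_coeff n p m"
    by (auto simp: zero_less_fun_iff)
  \<comment> \<open>A non-zero coefficient forces \<open>m\<close> to be a count vector, hence the
    counts of some tuple.\<close>
  then obtain x where "m = count_list x"
    using bern_coeff_outside[OF p n(1), of m] by (force simp: count_vectors_eq)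
  with m have "(\<lambda>_. 0) < (\<lambda>x. bern_coeff n p (count_list x))"
    by (auto simp: zero_less_fun_iff)
  then show "p \<in> bernstein_positive"
    using bern_coeff_gamble[OF p n(1)] unfolding bernstein_positive_def
    by (intro CollectI exI[of _ n] exI[of _ "\<lambda>x. bern_coeff n p (count_list x)"]) simp
next
  assume "p \<in> bernstein_positive"
  then obtain n f where f: "p = Mn n f" "f \<in> gambles (tuples n)" "(\<lambda>_. 0) < f"
    by (auto simp: bernstein_positive_def)
  then obtain x where x: "f x > 0" and nonneg: "\<And>x. 0 \<le> f x"
    by (auto simp: zero_less_fun_iff)
  then have "x \<in> tuples n"
    using f(2) by (force simp: gambles_tuples)
  moreover have "0 < (\<Sum>y\<in>atom (count_list x). f y)"
  proof (rule sum_pos2)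
    show "finite (atom (count_list x))"
      using \<open>x \<in> tuples n\<close>
      by (metis atom_subset_tuples count_list_in_count_vectors finite_subset finite_tuples)
  qed (use x nonneg in \<open>auto simp: atom_alt\<close>)
  ultimately have "0 < bern_coeff n p (count_list x)"
    using card_atom_pos[of "count_list x" n] by (simp add: f(1) bern_coeff_Mn)
  moreover have "0 \<le> bern_coeff n p m" for m
    by (simp add: f(1) bern_coeff_Mn nonneg sum_nonneg)
  ultimately have "(\<lambda>_. 0) < bern_coeff n p"
    by (auto simp: zero_less_fun_iff)
  then show "\<exists>n\<ge>deg p. (\<lambda>_. 0) < bern_coeff n p"
    using deg_Mn_le f(1) by blast
qed

text \<open>Coefficients change sign with the polynomial, so lifting to tuples and averaging over
  atoms are applied to \<open>- p\<close>.\<close>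

lemma bernstein_nonpositive_iff:
  fixes p :: "('a::finite \<Rightarrow> real) \<Rightarrow> real"
  assumes p: "p \<in> polys"
  shows "(\<exists>n\<ge>deg p. bern_coeff n p \<le> (\<lambda>_. 0)) \<longleftrightarrow> (\<lambda>\<theta>. - p \<theta>) \<in> bernstein_nonnegative"
proof
  assume "\<exists>n\<ge>deg p. bern_coeff n p \<le> (\<lambda>_. 0)"
  then obtain n where n: "deg p \<le> n" "bern_coeff n p \<le> (\<lambda>_. 0)"
    by blast
  let ?f = "\<lambda>x. - bern_coeff n p (count_list x)"
  have "?f \<in> gambles (tuples n)" "(\<lambda>_. 0) \<le> ?f" "(\<lambda>\<theta>. - p \<theta>) = Mn n ?f"
    using bern_coeff_gamble[OF p n(1)] n(2) by (simp_all add: Mn_uminus gambles_tuples le_fun_def)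
  then show "(\<lambda>\<theta>. - p \<theta>) \<in> bernstein_nonnegative"
    unfolding bernstein_nonnegative_def by blast
next
  assume "(\<lambda>\<theta>. - p \<theta>) \<in> bernstein_nonnegative"
  then obtain n f where f: "(\<lambda>\<theta>. - p \<theta>) = Mn n f" "(\<lambda>_. 0) \<le> f"
    by (auto simp: bernstein_nonnegative_def)
  have "p = Mn n (\<lambda>x. - f x)"
    by (simp add: Mn_uminus flip: f(1))
  moreover have "bern_coeff n (Mn n (\<lambda>x. - f x)) \<le> (\<lambda>_. 0)"
    using f(2) by (simp add: bern_coeff_Mn le_fun_def sum_negf sum_nonneg)
  ultimately show "\<exists>n\<ge>deg p. bern_coeff n p \<le> (\<lambda>_. 0)"
    using deg_Mn_le by blast
qed

subsection \<open>Exchangeability\<close>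

text \<open>
  Since the difference \<open>d\<close> sums to zero over each atom, it is the sum over all tuples \<open>x\<close> of \<open>d x\<close>
  times the indicator of \<open>x\<close> minus that of a fixed representative of its atom, and these two
  indicators are related by a permutation.
\<close>

lemma exchangeable_Mn_eq:
  fixes g h :: "'a::finite list \<Rightarrow> real"
  assumes exch: "exchangeable_set n R" and "R \<subseteq> gambles (tuples n)"
    and h: "h \<in> R" and g: "g \<in> gambles (tuples n)" and eq: "Mn n g = Mn n h"
  shows "g \<in> R"
proof -
  define d where "d x = g x - h x" for x
  have d_outside: "d x = 0" if "x \<notin> tuples n" for x
    using that assms by (auto simp: d_def gambles_tuples)
  \<comment> \<open>Uniqueness of Bernstein coefficients turns this equation into vanishing sums of
    \<open>d\<close> over atoms.\<close>
  have "Mn n d = (\<lambda>_. 0)"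
    unfolding d_def Mn_diff eq by simp
  then have "bern_coeff n (Mn n d) = (\<lambda>_. 0)"
    by (simp add: bern_coeff_eqI gambles_count_vectors)
  then have d_atom: "(\<Sum>y\<in>atom m. d y) = 0" if "m \<in> count_vectors n" for m
    using that card_atom_pos[OF that] by (auto simp: bern_coeff_Mn dest!: fun_cong[of _ _ m])
  define rep where "rep m = (SOME x. x \<in> atom m)" for m :: "'a \<Rightarrow> nat"
  have rep: "count_list (rep m) = m" for m
    using atom_nonempty[of m] someI_ex[of "\<lambda>x. x \<in> atom m"] by (auto simp: rep_def atom_alt)
  define e where "e x y = d x * (of_bool (y = x) - of_bool (y = rep (count_list x)))" for x y
  \<comment> \<open>Exchangeability allows the addition of one difference at a time, so the tuples
    are handled one by one.\<close>
  have "(\<lambda>y. h y + (\<Sum>x\<in>T. e x y)) \<in> R" if "T \<subseteq> tuples n" for T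
    using finite_subset[OF that finite_tuples] that
  proof (induction T rule: finite_induct)
    case empty
    then show ?case
      using h by simp
  next
    case (insert x T)
    let ?r = "rep (count_list x)"
    have x: "x \<in> tuples n"
      using insert.prems by simp
    then have r: "?r \<in> tuples n"
      by (metis count_list_in_count_vectors rep)
    have "mset x = mset ?r"
      by (simp add: multiset_eq_iff count_mset rep)
    then obtain \<pi> where "\<pi> permutes {..<length ?r}" and \<pi>_r: "permute_list \<pi> ?r = x"
      by (rule mset_eq_permutation)
    then have \<pi>: "\<pi> permutes {..<n}"
      using r by (simp add: tuples_def)
    \<comment> \<open>Permuting positions is injective on tuples, so \<open>?r\<close> is the only
      preimage of \<open>x\<close>. Composing the indicator of \<open>x\<close> with the permutation
      therefore gives the indicator of \<open>?r\<close>.\<close>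
    have "y = ?r" if "permute_list \<pi> y = x" for y
    proof -
      have "y \<in> tuples n"
        using that x by (auto simp: tuples_def)
      then show ?thesis
        using that r \<pi>_r bij_betw_imp_inj_on[OF bij_betw_permute_list_tuples[OF \<pi>]]
        by (metis inj_onD)
    qed
    then have iff: "permute_list \<pi> y = x \<longleftrightarrow> y = ?r" for y
      using \<pi>_r by blast
    have "(\<lambda>y. d x * of_bool (y = x)) \<in> gambles (tuples n)"
      using x by (auto simp: gambles_tuples)
    then have "(\<lambda>y. (h y + (\<Sum>x\<in>T. e x y)) +
        (d x * of_bool (y = x) - d x * of_bool (permute_list \<pi> y = x))) \<in> R"
      using exch[unfolded exchangeable_set_def, rule_format, OF _ _ \<pi>] insert.IH insert.prems
      by simp
    then have "(\<lambda>y. (h y + (\<Sum>x\<in>T. e x y)) + (d x * of_bool (y = x) - d x * of_bool (y = ?r))) \<in> R"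
      by (simp add: iff)
    then show ?case
      using insert.hyps by (simp add: e_def algebra_simps)
  qed
  then have "(\<lambda>y. h y + (\<Sum>x\<in>tuples n. e x y)) \<in> R"
    by blast
  moreover have "h y + (\<Sum>x\<in>tuples n. e x y) = g y" for y
  proof -
    \<comment> \<open>Grouped by atoms, the contributions of the representatives contain the sum of
      \<open>d\<close> over an atom as a factor.\<close>
    have "(\<Sum>x\<in>tuples n. d x * of_bool (y = rep (count_list x)))
        = (\<Sum>m\<in>count_vectors n. \<Sum>x\<in>atom m. d x * of_bool (y = rep m))"
      by (subst sum_tuples_by_atom[symmetric]) (simp add: atom_alt)
    also have "\<dots> = 0"
      by (simp add: d_atom flip: sum_distrib_right)
    finally have "(\<Sum>x\<in>tuples n. e x y) = (\<Sum>x\<in>tuples n. d x * of_bool (y = x))"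
      by (simp add: e_def right_diff_distrib sum_subtractf)
    also have "\<dots> = d y"
      using d_outside by (simp add: of_bool_def if_distrib[of "\<lambda>c. _ * c"] cong: if_cong)
    finally show ?thesis
      by (simp add: d_def)
  qed
  ultimately show ?thesis
    by simp
qed

subsection \<open>Cones of polynomials\<close>

lemma posiE:
  assumes "p \<in> posi H"
  obtains n :: nat and c q where "p = (\<lambda>x. \<Sum>k=1..n. c k * q k x)" and "1 \<le> n"
    and "\<forall>k\<in>{1..n}. q k \<in> H \<and> 0 < c k"
  using assms unfolding posi_def mem_Collect_eq by (elim exE conjE) (rule that)

lemma posi_superset: "H \<subseteq> posi H"
proof
  fix p
  assume "p \<in> H"
  then show "p \<in> posi H"
    unfolding posi_def
    by (intro CollectI exI[of _ 1] exI[of _ "\<lambda>_. 1"] exI[of _ "\<lambda>_. p"]) simp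
qed

lemma posi_scale:
  assumes "p \<in> posi H" and "0 < c"
  shows "(\<lambda>x. c * p x) \<in> posi H"
proof -
  obtain n :: nat and d q where "p = (\<lambda>x. \<Sum>k=1..n. d k * q k x)" "1 \<le> n" "\<forall>k\<in>{1..n}. q k \<in> H \<and> 0 < d k"
    using assms(1) by (rule posiE)
  then show ?thesis
    unfolding posi_def using assms(2)
    by (intro CollectI exI[of _ n] exI[of _ "\<lambda>k. c * d k"] exI[of _ q])
      (simp add: sum_distrib_left mult.assoc)
qed

lemma posi_add:
  assumes "p \<in> posi H" and "p' \<in> posi H"
  shows "(\<lambda>x. p x + p' x) \<in> posi H"
proof -
  obtain n :: nat and d q where p: "p = (\<lambda>x. \<Sum>k=1..n. d k * q k x)" "1 \<le> n"
    "\<forall>k\<in>{1..n}. q k \<in> H \<and> 0 < d k"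
    using assms(1) by (rule posiE)
  obtain n' :: nat and d' q' where p': "p' = (\<lambda>x. \<Sum>k=1..n'. d' k * q' k x)" "1 \<le> n'"
    "\<forall>k\<in>{1..n'}. q' k \<in> H \<and> 0 < d' k"
    using assms(2) by (rule posiE)
  \<comment> \<open>Indices up to \<open>n\<close> run through the first combination; the later
    ones, shifted by \<open>n\<close>, run through the second.\<close>
  define e where "e k = (if k \<le> n then d k else d' (k - n))" for k
  define r where "r k = (if k \<le> n then q k else q' (k - n))" for k
  have "p x + p' x = (\<Sum>k=1..n + n'. e k * r k x)" for x
  proof -
    have "(\<Sum>k=1..n + n'. e k * r k x) = (\<Sum>k=1..n. e k * r k x) + (\<Sum>k=n+1..n+n'. e k * r k x)"
      by (rule sum.ub_add_nat) simp
    also have "(\<Sum>k=n+1..n+n'. e k * r k x) = (\<Sum>k=1..n'. e (k + n) * r (k + n) x)"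
      using sum.shift_bounds_cl_nat_ivl[of "\<lambda>k. e k * r k x" 1 n n'] by (simp add: add.commute)
    finally show ?thesis
      by (simp add: p(1) p'(1) e_def r_def)
  qed
  moreover have "r k \<in> H \<and> 0 < e k" if "k \<in> {1..n + n'}" for k
  proof (cases "k \<le> n")
    case True
    then show ?thesis
      using that p(3) by (simp add: e_def r_def)
  next
    case False
    then have "k - n \<in> {1..n'}"
      using that by auto
    then show ?thesis
      using False p'(3) by (simp add: e_def r_def)
  qed
  ultimately show ?thesis
    unfolding posi_def using p(2)
    by (intro CollectI exI[of _ "n + n'"] exI[of _ e] exI[of _ r]) auto
qed

text \<open>Elements of \<open>posi H\<close> are non-empty finite sums of positive multiples, so
  the two closure properties build each of them.\<close>

lemma posi_least:
  assumes "H \<subseteq> K"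
    and scale: "\<And>p c. p \<in> K \<Longrightarrow> 0 < c \<Longrightarrow> (\<lambda>x. c * p x) \<in> K"
    and add: "\<And>p q. p \<in> K \<Longrightarrow> q \<in> K \<Longrightarrow> (\<lambda>x. p x + q x) \<in> K"
  shows "posi H \<subseteq> K"
proof
  fix p
  assume "p \<in> posi H"
  then obtain n :: nat and c q where p: "p = (\<lambda>x. \<Sum>k=1..n. c k * q k x)" "1 \<le> n"
    "\<forall>k\<in>{1..n}. q k \<in> H \<and> 0 < c k"
    by (rule posiE)
  have "(\<lambda>x. \<Sum>k=1..n. c k * q k x) \<in> K"
    using p(2,3)
  \<comment> \<open>The induction starts at 1, since \<open>K\<close> may fail to contain the empty
    sum.\<close>
  proof (induction n rule: dec_induct)
    case base
    then show ?case
      using assms(1) scale by auto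
  next
    case (step n)
    then have "q (Suc n) \<in> K" "0 < c (Suc n)"
      using assms(1) by auto
    then show ?case
      using step add[OF _ scale] by simp
  qed
  then show "p \<in> K"
    by (simp add: p(1))
qed

text \<open>Degree elevation reaches every level above both degrees; the maximum with 1 makes the
  level one at which families are defined.\<close>

lemma polys_common_level:
  fixes p q :: "('a::finite \<Rightarrow> real) \<Rightarrow> real"
  assumes "p \<in> polys" and "q \<in> polys"
  obtains n f g where "1 \<le> n" "f \<in> gambles (tuples n)" "g \<in> gambles (tuples n)"
    "p = Mn n f" "q = Mn n g"
proof -
  define n where "n = max 1 (max (deg p) (deg q))"
  have n: "1 \<le> n" "deg p \<le> n" "deg q \<le> n"
    by (simp_all add: n_def)
  obtain f where "f \<in> gambles (tuples n)" "p = Mn n f"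
    using polys_eq_Mn[OF assms(1) n(2)] .
  moreover obtain g where "g \<in> gambles (tuples n)" "q = Mn n g"
    using polys_eq_Mn[OF assms(2) n(3)] .
  ultimately show thesis
    using that n(1) by blast
qed

lemma polys_add:
  assumes "p \<in> polys" and "q \<in> polys"
  shows "(\<lambda>\<theta>. p \<theta> + q \<theta>) \<in> polys"
proof -
  obtain n f g where "p = Mn n f" "q = Mn n g"
    by (rule polys_common_level[OF assms])
  then show ?thesis
    by (simp add: Mn_in_polys flip: Mn_add)
qed

lemma polys_scale:
  assumes "p \<in> polys"
  shows "(\<lambda>\<theta>. c * p \<theta>) \<in> polys"
proof -
  obtain n f where "p = Mn n f"
    using polys_common_level[OF assms assms] by metis
  then show ?thesis
    by (simp add: Mn_in_polys flip: Mn_scale)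
qed

section \<open>The cones of Bernstein positive and non-negative polynomials\<close>

lemma bernstein_positive_subset_nonnegative: "bernstein_positive \<subseteq> bernstein_nonnegative"
  unfolding bernstein_positive_def bernstein_nonnegative_def by (blast intro: less_imp_le)

lemma bernstein_nonnegative_subset_polys: "bernstein_nonnegative \<subseteq> polys"
  by (auto simp: bernstein_nonnegative_def Mn_in_polys)

lemma zero_in_bernstein_nonnegative: "(\<lambda>_. 0) \<in> bernstein_nonnegative"
  unfolding bernstein_nonnegative_def
  by (intro CollectI exI[of _ "0::nat"] exI[of _ "\<lambda>_. 0"]) (simp add: Mn_zero gambles_tuples)

lemma bernstein_nonnegative_scale:
  assumes "p \<in> bernstein_nonnegative" and "0 < c"
  shows "(\<lambda>\<theta>. c * p \<theta>) \<in> bernstein_nonnegative"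
proof -
  obtain n f where f: "p = Mn n f" "f \<in> gambles (tuples n)" "(\<lambda>_. 0) \<le> f"
    using assms(1) by (auto simp: bernstein_nonnegative_def)
  show ?thesis
    unfolding bernstein_nonnegative_def using f assms(2)
    by (intro CollectI exI[of _ n] exI[of _ "\<lambda>x. c * f x"])
      (simp add: Mn_scale gambles_tuples le_fun_def)
qed

lemma bernstein_positive_scale:
  assumes "p \<in> bernstein_positive" and "0 < c"
  shows "(\<lambda>\<theta>. c * p \<theta>) \<in> bernstein_positive"
proof -
  obtain n f where f: "p = Mn n f" "f \<in> gambles (tuples n)" "(\<lambda>_. 0) < f"
    using assms(1) by (auto simp: bernstein_positive_def)
  have "(\<lambda>_. 0) < (\<lambda>x. c * f x)"
    using f(3) assms(2) unfolding zero_less_fun_iff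
    by (metis mult_nonneg_nonneg mult_pos_pos less_imp_le)
  then show ?thesis
    unfolding bernstein_positive_def using f(1,2)
    by (intro CollectI exI[of _ n] exI[of _ "\<lambda>x. c * f x"]) (simp add: Mn_scale gambles_tuples)
qed

text \<open>Extension to the larger tuple length changes neither the images under \<open>Mn\<close>
  nor the signs, so both gambles can be added there.\<close>

lemma bernstein_nonnegative_add:
  assumes "p \<in> bernstein_nonnegative" and "q \<in> bernstein_nonnegative"
  shows "(\<lambda>\<theta>. p \<theta> + q \<theta>) \<in> bernstein_nonnegative"
proof -
  obtain n f where f: "p = Mn n f" "f \<in> gambles (tuples n)" "(\<lambda>_. 0) \<le> f"
    using assms(1) by (auto simp: bernstein_nonnegative_def)
  obtain k g where g: "q = Mn k g" "g \<in> gambles (tuples k)" "(\<lambda>_. 0) \<le> g"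
    using assms(2) by (auto simp: bernstein_nonnegative_def)
  let ?N = "max n k"
  let ?h = "\<lambda>x. ext n ?N f x + ext k ?N g x"
  have "(\<lambda>\<theta>. p \<theta> + q \<theta>) = Mn ?N ?h"
    by (simp add: Mn_add Mn_ext f(1) g(1))
  moreover have "?h \<in> gambles (tuples ?N)" "(\<lambda>_. 0) \<le> ?h"
    using f(3) g(3) by (simp_all add: gambles_tuples ext_def le_fun_def)
  ultimately show ?thesis
    unfolding bernstein_nonnegative_def by blast
qed

lemma bernstein_positive_add:
  assumes "p \<in> bernstein_positive" and "q \<in> bernstein_nonnegative"
  shows "(\<lambda>\<theta>. p \<theta> + q \<theta>) \<in> bernstein_positive"
proof -
  obtain n f where f: "p = Mn n f" "f \<in> gambles (tuples n)" "(\<lambda>_. 0) < f"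
    using assms(1) by (auto simp: bernstein_positive_def)
  obtain k g where g: "q = Mn k g" "g \<in> gambles (tuples k)" "(\<lambda>_. 0) \<le> g"
    using assms(2) by (auto simp: bernstein_nonnegative_def)
  let ?N = "max n k"
  let ?h = "\<lambda>x. ext n ?N f x + ext k ?N g x"
  have "(\<lambda>\<theta>. p \<theta> + q \<theta>) = Mn ?N ?h"
    by (simp add: Mn_add Mn_ext f(1) g(1))
  moreover have "?h \<in> gambles (tuples ?N)"
    by (simp add: gambles_tuples ext_def)
  moreover have "(\<lambda>_. 0) < ?h"
    using ext_pos[OF _ f(2,3), of ?N] ext_nonneg[OF g(3), of k ?N]
    unfolding zero_less_fun_iff by (force simp: le_fun_def intro: add_pos_nonneg)
  ultimately show ?thesis
    unfolding bernstein_positive_def by blast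
qed

text \<open>
  At the uniform distribution every tuple has the same positive weight, so a polynomial with
  Bernstein coefficients \<open>> 0\<close> is positive there.
\<close>

lemma zero_notin_bernstein_positive: "(\<lambda>_. 0) \<notin> (bernstein_positive :: (('a::finite \<Rightarrow> real) \<Rightarrow> real) set)"
proof
  assume "(\<lambda>_. 0) \<in> (bernstein_positive :: (('a \<Rightarrow> real) \<Rightarrow> real) set)"
  then obtain n and f :: "'a list \<Rightarrow> real"
    where f: "Mn n f = (\<lambda>_. 0)" "f \<in> gambles (tuples n)" "(\<lambda>_. 0) < f"
    by (auto simp: bernstein_positive_def)
  define \<theta> where "\<theta> = (\<lambda>_::'a. 1 / real (card (UNIV :: 'a set)))"
  have "\<theta> \<in> simplex"
    by (simp add: simplex_def \<theta>_def)
  moreover obtain x where x: "0 < f x" and nonneg: "\<forall>x. 0 \<le> f x"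
    using f(3) by (auto simp: zero_less_fun_iff)
  moreover have "x \<in> tuples n"
    using x f(2) by (force simp: gambles_tuples)
  moreover have weight: "0 < prod_list (map \<theta> y)" for y
    by (induction y) (simp_all add: \<theta>_def card_gt_0_iff)
  ultimately have "0 < Mn n f \<theta>"
    unfolding Mn_simplex[OF \<open>\<theta> \<in> simplex\<close>]
    by (intro sum_pos2[of _ x]) (simp_all add: less_imp_le)
  then show False
    by (simp add: f(1))
qed

section \<open>Bernstein coherence and avoiding Bernstein non-positivity\<close>

lemma bernstein_coherent_alt:
  "bernstein_coherent H \<longleftrightarrow> H \<subseteq> polys \<and> (\<lambda>_. 0) \<notin> H \<and> bernstein_positive \<subseteq> H \<and>
    (\<forall>p\<in>H. \<forall>c>0. (\<lambda>\<theta>. c * p \<theta>) \<in> H) \<and> (\<forall>p\<in>H. \<forall>q\<in>H. (\<lambda>\<theta>. p \<theta> + q \<theta>) \<in> H)"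
proof -
  have "(\<forall>p\<in>polys. (\<exists>n\<ge>deg p. (\<lambda>_. 0) < bern_coeff n p) \<longrightarrow> p \<in> H) \<longleftrightarrow> bernstein_positive \<subseteq> H"
    using bernstein_positive_iff bernstein_positive_subset_nonnegative
      bernstein_nonnegative_subset_polys by blast
  then show ?thesis
    unfolding bernstein_coherent_def by simp
qed

lemma bernstein_coherentD:
  assumes "bernstein_coherent H"
  shows "H \<subseteq> polys" and "(\<lambda>_. 0) \<notin> H" and "bernstein_positive \<subseteq> H"
    and "p \<in> H \<Longrightarrow> 0 < c \<Longrightarrow> (\<lambda>\<theta>. c * p \<theta>) \<in> H"
    and "p \<in> H \<Longrightarrow> q \<in> H \<Longrightarrow> (\<lambda>\<theta>. p \<theta> + q \<theta>) \<in> H"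
proof -
  note H = assms[unfolded bernstein_coherent_alt]
  show "H \<subseteq> polys"
    using H by (elim conjE)
  show "(\<lambda>_. 0) \<notin> H"
    using H by (elim conjE)
  show "bernstein_positive \<subseteq> H"
    using H by (elim conjE)
  have scale: "\<forall>p\<in>H. \<forall>c>0. (\<lambda>\<theta>. c * p \<theta>) \<in> H"
    using H by (elim conjE)
  have add: "\<forall>p\<in>H. \<forall>q\<in>H. (\<lambda>\<theta>. p \<theta> + q \<theta>) \<in> H"
    using H by (elim conjE)
  show "(\<lambda>\<theta>. c * p \<theta>) \<in> H" if "p \<in> H" "0 < c"
    by (rule scale[rule_format, OF that])
  show "(\<lambda>\<theta>. p \<theta> + q \<theta>) \<in> H" if "p \<in> H" "q \<in> H"
    by (rule add[rule_format, OF that])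
qed

lemma avoids_bernstein_nonpositivity_alt:
  assumes "H \<subseteq> polys"
  shows "avoids_bernstein_nonpositivity H \<longleftrightarrow>
    (\<forall>p\<in>posi H. (\<lambda>\<theta>. - p \<theta>) \<notin> bernstein_nonnegative)"
proof -
  have "posi H \<subseteq> polys"
    using assms by (rule posi_least) (simp_all add: polys_scale polys_add)
  then show ?thesis
    unfolding avoids_bernstein_nonpositivity_def using bernstein_nonpositive_iff by blast
qed

text \<open>If \<open>- p\<close> is Bernstein non-negative, it is zero or Bernstein positive. In
  both cases \<open>p \<in> K\<close> puts zero into \<open>K\<close>.\<close>

lemma bernstein_coherent_avoids:
  assumes "bernstein_coherent K" and "H \<subseteq> K"
  shows "avoids_bernstein_nonpositivity H"
proof -
  note K = bernstein_coherentD[OF assms(1)]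
  have "(\<lambda>\<theta>. - p \<theta>) \<notin> bernstein_nonnegative" if "p \<in> posi H" for p
  proof
    assume "(\<lambda>\<theta>. - p \<theta>) \<in> bernstein_nonnegative"
    then obtain n f where f: "(\<lambda>\<theta>. - p \<theta>) = Mn n f" "f \<in> gambles (tuples n)" "(\<lambda>_. 0) \<le> f"
      by (auto simp: bernstein_nonnegative_def)
    have "p \<in> K"
      using that posi_least[of H K] assms(2) K(4,5) by blast
    show False
    proof (cases "f = (\<lambda>_. 0)")
      case True
      then have "- p \<theta> = 0" for \<theta>
        using fun_cong[OF f(1), of \<theta>] by (simp add: Mn_zero)
      then have "p = (\<lambda>_. 0)"
        by (simp add: fun_eq_iff)
      then show ?thesis
        using \<open>p \<in> K\<close> K(2) by simp
    next
      case False
      then have "(\<lambda>\<theta>. - p \<theta>) \<in> bernstein_positive"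
        using f unfolding bernstein_positive_def by (auto simp: less_le)
      then have "(\<lambda>\<theta>. p \<theta> + - p \<theta>) \<in> K"
        using K(3) \<open>p \<in> K\<close> by (intro K(5)) auto
      then show ?thesis
        using K(2) by simp
    qed
  qed
  then show ?thesis
    using avoids_bernstein_nonpositivity_alt[of H] assms(2) K(1) by blast
qed

text \<open>The witness is the cone generated by \<open>H\<close> and the Bernstein positive
  polynomials. Zero could enter it only as \<open>p + q\<close> with \<open>p \<in> posi H\<close>
  and \<open>q\<close> Bernstein non-negative, which makes \<open>- p\<close> Bernstein
  non-negative.\<close>

lemma avoids_bernstein_coherent:
  assumes polys: "H \<subseteq> polys" and avoids: "avoids_bernstein_nonpositivity H"
  obtains K where "bernstein_coherent K" and "H \<subseteq> K"
proof -
  \<comment> \<open>Non-negative summands include zero, which gives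
    \<open>posi H \<subseteq> C\<close>. The Bernstein positive polynomials are adjoined separately:
    for empty \<open>H\<close>, the set \<open>C\<close> is empty.\<close>
  define C where "C = (\<lambda>(p, q) \<theta>. p \<theta> + q \<theta>) ` (posi H \<times> bernstein_nonnegative)"
  define K where "K = bernstein_positive \<union> C"
  have posi_polys: "posi H \<subseteq> polys"
    using polys by (rule posi_least) (simp_all add: polys_scale polys_add)
  have C_add: "(\<lambda>\<theta>. r \<theta> + s \<theta>) \<in> C" if r: "r \<in> C" and s: "s \<in> bernstein_nonnegative" for r s
  proof -
    obtain p q where "r = (\<lambda>\<theta>. p \<theta> + q \<theta>)" "p \<in> posi H" "q \<in> bernstein_nonnegative"
      using r by (auto simp: C_def)
    then show ?thesis
      unfolding C_def using bernstein_nonnegative_add[OF _ s]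
      by (intro image_eqI[of _ _ "(p, \<lambda>\<theta>. q \<theta> + s \<theta>)"]) (simp_all add: add.assoc)
  qed
  have H_C: "posi H \<subseteq> C"
  proof
    fix p
    assume "p \<in> posi H"
    then show "p \<in> C"
      unfolding C_def using zero_in_bernstein_nonnegative
      by (intro image_eqI[of _ _ "(p, \<lambda>_. 0)"]) simp_all
  qed
  have "bernstein_coherent K"
    unfolding bernstein_coherent_alt
  proof (intro conjI ballI allI impI)
    show "K \<subseteq> polys"
      using bernstein_positive_subset_nonnegative bernstein_nonnegative_subset_polys posi_polys
      by (auto simp: K_def C_def intro!: polys_add)
    show "(\<lambda>_. 0) \<notin> K"
    proof
      assume "(\<lambda>_. 0) \<in> K"
      then have "(\<lambda>_. 0) \<in> C"
        by (simp add: K_def zero_notin_bernstein_positive)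
      then obtain p q where pq: "(\<lambda>_. 0) = (\<lambda>\<theta>. p \<theta> + q \<theta>)" "p \<in> posi H"
          "q \<in> bernstein_nonnegative"
        by (auto simp: C_def)
      have "(\<lambda>\<theta>. - p \<theta>) = q"
      proof
        fix \<theta>
        show "- p \<theta> = q \<theta>"
          using fun_cong[OF pq(1), of \<theta>] by simp
      qed
      then show False
        using pq(2,3) avoids avoids_bernstein_nonpositivity_alt[OF polys] by blast
    qed
    show "bernstein_positive \<subseteq> K"
      by (simp add: K_def)
    show "(\<lambda>\<theta>. c * r \<theta>) \<in> K" if "r \<in> K" "0 < c" for r c
      using that(1) unfolding K_def
    proof
      assume "r \<in> C"
      then obtain p q where r: "r = (\<lambda>\<theta>. p \<theta> + q \<theta>)"
          and pq: "p \<in> posi H" "q \<in> bernstein_nonnegative"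
        by (auto simp: C_def)
      have "(\<lambda>\<theta>. c * r \<theta>) \<in> C"
        unfolding C_def r
        using posi_scale[OF pq(1) that(2)] bernstein_nonnegative_scale[OF pq(2) that(2)]
        by (intro image_eqI[of _ _ "(\<lambda>\<theta>. c * p \<theta>, \<lambda>\<theta>. c * q \<theta>)"])
          (simp_all add: distrib_left)
      then show "(\<lambda>\<theta>. c * r \<theta>) \<in> bernstein_positive \<union> C" ..
    qed (simp add: bernstein_positive_scale that(2))
    \<comment> \<open>A sum with a summand in \<open>C\<close> stays in \<open>C\<close>, which
      absorbs Bernstein non-negative polynomials; otherwise both summands are Bernstein
      positive.\<close>
    show "(\<lambda>\<theta>. r \<theta> + s \<theta>) \<in> K" if "r \<in> K" "s \<in> K" for r s
    proof (cases "s \<in> C")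
      case s: True
      show ?thesis
      proof (cases "r \<in> C")
        case True
        obtain p q where pq: "s = (\<lambda>\<theta>. p \<theta> + q \<theta>)" "p \<in> posi H" "q \<in> bernstein_nonnegative"
          using s by (auto simp: C_def)
        obtain p' q' where pq': "r = (\<lambda>\<theta>. p' \<theta> + q' \<theta>)" "p' \<in> posi H" "q' \<in> bernstein_nonnegative"
          using True by (auto simp: C_def)
        have "(\<lambda>\<theta>. p' \<theta> + p \<theta>) \<in> C"
          using H_C posi_add[OF pq'(2) pq(2)] by blast
        from C_add[OF C_add[OF this pq'(3)] pq(3)] show ?thesis
          by (simp add: K_def pq(1) pq'(1) algebra_simps)
      next
        case False
        then have "r \<in> bernstein_nonnegative"
          using that(1) bernstein_positive_subset_nonnegative by (auto simp: K_def)
        from C_add[OF s this] show ?thesis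
          by (simp add: K_def add.commute)
      qed
    next
      case False
      then have s: "s \<in> bernstein_nonnegative"
        using that(2) bernstein_positive_subset_nonnegative by (auto simp: K_def)
      with that(1) show ?thesis
        using C_add bernstein_positive_add by (auto simp: K_def)
    qed
  qed
  moreover have "H \<subseteq> K"
    using H_C posi_superset by (fastforce simp: K_def)
  ultimately show thesis
    by (rule that)
qed

subsection \<open>Families and Bernstein coherent sets\<close>

text \<open>The inverse of \<open>frequency_representation\<close>: the full preimage of
  \<open>H\<close> under \<open>Mn n\<close>.\<close>

definition family_of :: "(('a::finite \<Rightarrow> real) \<Rightarrow> real) set \<Rightarrow> nat \<Rightarrow> ('a list \<Rightarrow> real) set" where
  "family_of H n = {f \<in> gambles (tuples n). Mn n f \<in> H}"

text \<open>Coherence transfers along the linear map \<open>Mn n\<close>. Exchangeability holds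
  because \<open>Mn n\<close> sends \<open>f\<close> minus its permuted version to zero, and time
  consistency because \<open>Mn\<close> is invariant under \<open>ext\<close>.\<close>

lemma family_of_coherent:
  fixes H :: "(('a::finite \<Rightarrow> real) \<Rightarrow> real) set"
  assumes "bernstein_coherent H"
  shows "coherent_exch_tc_family (family_of H)"
proof -
  note H = bernstein_coherentD[OF assms]
  have "coherent_set (tuples n) (family_of H n)" for n
    unfolding coherent_set_def
  proof (intro conjI ballI allI impI)
    show "(\<lambda>_. 0) \<notin> family_of H n"
      by (simp add: family_of_def Mn_zero H(2))
    show "f \<in> family_of H n" if "f \<in> gambles (tuples n)" "(\<lambda>_. 0) < f" for f
      using that H(3) by (auto simp: family_of_def bernstein_positive_def)
  qed (auto simp: family_of_def gambles_tuples Mn_scale Mn_add H(4,5))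
  moreover have "exchangeable_set n (family_of H n)" for n
    unfolding exchangeable_set_def
  proof (intro ballI allI impI)
    fix h f :: "'a list \<Rightarrow> real" and \<pi>
    assume h: "h \<in> family_of H n" and f: "f \<in> gambles (tuples n)" and \<pi>: "\<pi> permutes {..<n}"
    have "permute_list \<pi> x \<in> tuples n \<longleftrightarrow> x \<in> tuples n" for x :: "'a list"
      by (simp add: tuples_def)
    then have "(\<lambda>x. h x + (f x - f (permute_list \<pi> x))) \<in> gambles (tuples n)"
      using h f by (simp add: family_of_def gambles_tuples)
    moreover have "Mn n (\<lambda>x. h x + (f x - f (permute_list \<pi> x))) = Mn n h"
      by (simp add: Mn_add Mn_diff Mn_permute[OF \<pi>])
    ultimately show "(\<lambda>x. h x + (f x - f (permute_list \<pi> x))) \<in> family_of H n"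
      using h by (simp add: family_of_def)
  qed
  moreover have "time_consistent (family_of H)"
    by (auto simp: time_consistent_def family_of_def Mn_ext ext_in_gambles)
  ultimately show ?thesis
    by (simp add: coherent_exch_tc_family_def)
qed

text \<open>Every polynomial is an image under \<open>Mn n\<close> for some
  \<open>n \<ge> 1\<close>, so passing to preimages loses nothing.\<close>

lemma frequency_representation_family_of:
  assumes "bernstein_coherent H"
  shows "frequency_representation (family_of H) = H"
proof
  show "frequency_representation (family_of H) \<subseteq> H"
    by (auto simp: frequency_representation_def family_of_def)
  show "H \<subseteq> frequency_representation (family_of H)"
  proof
    fix p
    assume p: "p \<in> H"
    then have "p \<in> polys"
      using assms by (auto simp: bernstein_coherent_alt)
    then obtain n f where "1 \<le> n" "f \<in> gambles (tuples n)" "p = Mn n f"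
      using polys_common_level by metis
    with p show "p \<in> frequency_representation (family_of H)"
      by (auto simp: frequency_representation_def family_of_def)
  qed
qed

lemma family_ext:
  assumes "coherent_exch_tc_family R" and "1 \<le> n" and "n \<le> N" and "f \<in> R n"
  shows "ext n N f \<in> R N"
proof -
  have "time_consistent R"
    using assms(1) by (simp add: coherent_exch_tc_family_def)
  then have "ext n N ` R n = R N \<inter> ext n N ` gambles (tuples n)"
    using assms(2,3) by (simp add: time_consistent_def)
  then show ?thesis
    using assms(4) by blast
qed

text \<open>If \<open>f\<close> has the same image as some \<open>g \<in> R k\<close>, both are
  extended to a common length. There exchangeability passes membership from one extension to the
  other, and time consistency brings it back to \<open>f\<close>.\<close>

lemma family_of_frequency_representation:
  assumes R: "coherent_exch_tc_family R" and n: "1 \<le> n"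
  shows "family_of (frequency_representation R) n = R n"
proof
  have gambles: "R k \<subseteq> gambles (tuples k)" if "1 \<le> k" for k
    using R that by (simp add: coherent_exch_tc_family_def coherent_set_def)
  then show "R n \<subseteq> family_of (frequency_representation R) n"
    using n by (auto simp: family_of_def frequency_representation_def)
  show "family_of (frequency_representation R) n \<subseteq> R n"
  proof
    fix f
    assume "f \<in> family_of (frequency_representation R) n"
    then obtain k g where f: "f \<in> gambles (tuples n)" and k: "1 \<le> k"
        and g: "g \<in> R k" and eq: "Mn n f = Mn k g"
      by (auto simp: family_of_def frequency_representation_def)
    let ?N = "max n k"
    have "ext n ?N f \<in> R ?N"
    proof (rule exchangeable_Mn_eq)
      show "exchangeable_set ?N (R ?N)"
        using R n by (simp add: coherent_exch_tc_family_def)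
      show "ext k ?N g \<in> R ?N"
        using R k g by (intro family_ext) auto
    qed (use n gambles in \<open>simp_all add: ext_in_gambles Mn_ext eq\<close>)
    \<comment> \<open>Time consistency from right to left: an extension lying in \<open>R ?N\<close>
      is the extension of a member of \<open>R n\<close>, which by injectivity is
      \<open>f\<close>.\<close>
    then have "ext n ?N f \<in> ext n ?N ` R n"
      using R n f unfolding coherent_exch_tc_family_def time_consistent_def by simp
    then show "f \<in> R n"
      using inj_on_ext[of n ?N] f gambles[OF n] by (auto dest: inj_onD)
  qed
qed

text \<open>Sums of polynomials from different levels are formed after extension to a common level,
  where \<open>R\<close> is coherent. Zero is excluded because \<open>R 1\<close> is recovered from
  the representation and would contain the zero gamble.\<close>

lemma bernstein_coherent_frequency_representation:
  fixes R :: "nat \<Rightarrow> ('a::finite list \<Rightarrow> real) set"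
  assumes R: "coherent_exch_tc_family R"
  shows "bernstein_coherent (frequency_representation R)"
proof -
  let ?H = "frequency_representation R"
  have coherent: "coherent_set (tuples n) (R n)" if "1 \<le> n" for n
    using R that by (simp add: coherent_exch_tc_family_def)
  have Mn_H: "Mn n f \<in> ?H" if "1 \<le> n" "f \<in> R n" for n f
    using that by (auto simp: frequency_representation_def)
  show ?thesis
    unfolding bernstein_coherent_alt
  proof (intro conjI ballI allI impI)
    show "?H \<subseteq> polys"
      by (auto simp: frequency_representation_def Mn_in_polys)
    show "(\<lambda>_. 0) \<notin> ?H"
    proof
      assume "(\<lambda>_. 0) \<in> ?H"
      then have "(\<lambda>_. 0) \<in> family_of ?H 1"
        by (simp add: family_of_def Mn_zero gambles_tuples)
      then show False
        using coherent[of 1] family_of_frequency_representation[OF R, of 1]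
        by (simp add: coherent_set_def)
    qed
    show "bernstein_positive \<subseteq> ?H"
    proof
      fix p :: "('a \<Rightarrow> real) \<Rightarrow> real"
      assume "p \<in> bernstein_positive"
      then obtain n f where f: "p = Mn n f" "f \<in> gambles (tuples n)" "(\<lambda>_. 0) < f"
        by (auto simp: bernstein_positive_def)
      \<comment> \<open>The index \<open>n\<close> in \<open>bernstein_positive\<close> may be 0,
        whereas the coherence of \<open>R\<close> starts at level 1.\<close>
      let ?N = "max 1 n"
      have "(\<lambda>_. 0) < ext n ?N f"
        by (rule ext_pos[OF _ f(2,3)]) simp
      moreover have "\<forall>g\<in>gambles (tuples ?N). (\<lambda>_. 0) < g \<longrightarrow> g \<in> R ?N"
        using coherent[of ?N] by (simp add: coherent_set_def)
      ultimately have "ext n ?N f \<in> R ?N"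
        using ext_in_gambles by blast
      then have "Mn ?N (ext n ?N f) \<in> ?H"
        by (intro Mn_H) simp_all
      then show "p \<in> ?H"
        by (simp add: Mn_ext f(1))
    qed
    show "(\<lambda>\<theta>. c * p \<theta>) \<in> ?H" if p: "p \<in> ?H" and c: "0 < c" for p c
    proof -
      obtain n f where f: "p = Mn n f" "1 \<le> n" "f \<in> R n"
        using p by (auto simp: frequency_representation_def)
      then have "(\<lambda>x. c * f x) \<in> R n"
        using coherent[OF f(2)] c by (simp add: coherent_set_def)
      then have "Mn n (\<lambda>x. c * f x) \<in> ?H"
        by (rule Mn_H[OF f(2)])
      then show ?thesis
        by (simp add: Mn_scale f(1))
    qed
    show "(\<lambda>\<theta>. p \<theta> + q \<theta>) \<in> ?H" if p: "p \<in> ?H" and q: "q \<in> ?H" for p q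
    proof -
      obtain n f where f: "p = Mn n f" "1 \<le> n" "f \<in> R n"
        using p by (auto simp: frequency_representation_def)
      obtain k g where g: "q = Mn k g" "1 \<le> k" "g \<in> R k"
        using q by (auto simp: frequency_representation_def)
      let ?N = "max n k"
      have "ext n ?N f \<in> R ?N" "ext k ?N g \<in> R ?N"
        using family_ext[OF R f(2) _ f(3), of ?N] family_ext[OF R g(2) _ g(3), of ?N] by simp_all
      moreover have "coherent_set (tuples ?N) (R ?N)"
        using f(2) by (intro coherent) simp
      then have "\<forall>f\<in>R ?N. \<forall>g\<in>R ?N. (\<lambda>x. f x + g x) \<in> R ?N"
        unfolding coherent_set_def by (elim conjE)
      ultimately have "(\<lambda>x. ext n ?N f x + ext k ?N g x) \<in> R ?N"
        by blast
      then have "Mn ?N (\<lambda>x. ext n ?N f x + ext k ?N g x) \<in> ?H"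
        using f(2) by (intro Mn_H) auto
      then show ?thesis
        by (simp add: Mn_add Mn_ext f(1) g(1))
    qed
  qed
qed

text \<open>Closure properties pass to intersections; a member of the non-empty collection bounds
  the intersection by \<open>polys\<close> and keeps zero out.\<close>

lemma bernstein_coherent_Inter:
  assumes "\<K> \<noteq> {}" and "\<And>K. K \<in> \<K> \<Longrightarrow> bernstein_coherent K"
  shows "bernstein_coherent (\<Inter>\<K>)"
  unfolding bernstein_coherent_alt
proof (intro conjI ballI allI impI)
  show "\<Inter>\<K> \<subseteq> polys" "(\<lambda>_. 0) \<notin> \<Inter>\<K>"
    using assms bernstein_coherentD(1,2) by blast+
  show "bernstein_positive \<subseteq> \<Inter>\<K>"
    using assms(2) bernstein_coherentD(3) by blast
  show "(\<lambda>\<theta>. c * p \<theta>) \<in> \<Inter>\<K>" if "p \<in> \<Inter>\<K>" "0 < c" for p c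
    using that by (intro InterI bernstein_coherentD(4)[OF assms(2)]) auto
  show "(\<lambda>\<theta>. p \<theta> + q \<theta>) \<in> \<Inter>\<K>" if "p \<in> \<Inter>\<K>" "q \<in> \<Inter>\<K>" for p q
    using that by (intro InterI bernstein_coherentD(5)[OF assms(2)]) auto
qed

section \<open>The natural extension and the smallest family\<close>

theorem theorem26:
  fixes A :: "nat \<Rightarrow> ('a::finite list \<Rightarrow> real) set"
    and P :: "(('a \<Rightarrow> real) \<Rightarrow> real) set"
  assumes A_gambles: "\<forall>n\<ge>1. A n \<subseteq> gambles (tuples n)"
    and P_eq: "P = (\<Union>n\<in>{1..}. Mn n ` A n)"
  shows "((\<exists>R. coherent_exch_tc_family R \<and> includes_assessment R A)
            \<longleftrightarrow> avoids_bernstein_nonpositivity P) \<and>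
         (avoids_bernstein_nonpositivity P \<longrightarrow>
            (\<exists>R. smallest_family_including A R \<and>
                 bernstein_natural_extension P = frequency_representation R))"
proof -
  have P_polys: "P \<subseteq> polys"
    by (auto simp: P_eq Mn_in_polys)
  have Mn_P: "Mn n f \<in> P" if "1 \<le> n" "f \<in> A n" for n f
    using that by (auto simp: P_eq)
  have frequency: "P \<subseteq> frequency_representation R" if "includes_assessment R A" for R
    using that unfolding includes_assessment_def P_eq frequency_representation_def by fastforce
  have smallest: "\<exists>R. smallest_family_including A R \<and>
      bernstein_natural_extension P = frequency_representation R"
    if avoids: "avoids_bernstein_nonpositivity P"
  proof -
    let ?E = "\<Inter>{K. bernstein_coherent K \<and> P \<subseteq> K}"
    obtain K where "bernstein_coherent K" "P \<subseteq> K"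
      using avoids_bernstein_coherent[OF P_polys avoids] .
    \<comment> \<open>The existence of \<open>K\<close> selects the intersection in the definition
      of the natural extension and makes the intersected collection non-empty.\<close>
    then have E: "bernstein_natural_extension P = ?E"
      and coherent: "bernstein_coherent ?E"
      by (auto simp: bernstein_natural_extension_def intro: bernstein_coherent_Inter)
    have "smallest_family_including A (family_of ?E)"
      unfolding smallest_family_including_def
    proof (intro conjI allI impI)
      show "coherent_exch_tc_family (family_of ?E)"
        using coherent by (rule family_of_coherent)
      show "includes_assessment (family_of ?E) A"
        unfolding includes_assessment_def family_of_def using A_gambles Mn_P by blast
      fix S n
      assume S: "coherent_exch_tc_family S \<and> includes_assessment S A" and n: "1 \<le> (n::nat)"
      \<comment> \<open>The frequency representation of a competing family is one of the sets
        intersected in \<open>?E\<close>. Since \<open>family_of\<close> is monotone and recovers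
        \<open>S n\<close>, the inclusion carries over to each level.\<close>
      then have "?E \<subseteq> frequency_representation S"
        using frequency bernstein_coherent_frequency_representation by blast
      then have "family_of ?E n \<subseteq> family_of (frequency_representation S) n"
        by (auto simp: family_of_def)
      then show "family_of ?E n \<subseteq> S n"
        using family_of_frequency_representation S n by blast
    qed
    then show ?thesis
      using E frequency_representation_family_of[OF coherent] by metis
  qed
  \<comment> \<open>Here the frequency representation of \<open>R\<close> is the Bernstein coherent
    superset of \<open>P\<close>.\<close>
  moreover have "avoids_bernstein_nonpositivity P"
    if "coherent_exch_tc_family R" "includes_assessment R A" for R
    using that frequency bernstein_coherent_frequency_representation bernstein_coherent_avoids
    by blast
  ultimately show ?thesis
    unfolding smallest_family_including_def by blast
qed

end
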